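(* Let $G$ be a connected graph. Then $G$ has a tree set $T$ of tame finite-order separations of $G$ which efficiently distinguishes all its inequivalent $\aleph_0$-tangles: for every two inequivalent $\aleph_0$-tangles $\tau_1,\tau_2$ of $G$ there is a separation in $T$ that distinguishes $\tau_1$ and $\tau_2$ efficiently. In particular, equivalent $\aleph_0$-tangles induce the same orientation on the tree set, i.e. $\tau_1\cap\vec T=\tau_2\cap\vec T$ whenever $\tau_1,\tau_2$ are equivalent, where $\vec T$ is the set of orientations of separations in $T$.
   Context: Graphs may be infinite of arbitrary cardinality; $G=(V,E)$. A separation of $G$ is an unordered pair $\{A,B\}$ with $A\cup B=V$ such that $G$ has no edge between $A\setminus B$ and $B\setminus A$; its separator is $A\cap B$, its order $|A\cap B|$. Its orientations are $(A,B)$ and $(B,A)$, each being the inverse of the other; oriented separations are ordered by $(A,B)\le(C,D)$ iff $A\subseteq C$ and $B\supseteq D$. $S_{\aleph_0}$ is the set of finite-order separations and $\vec S_{\aleph_0}$ the set of their orientations. For $X\subseteq V$, $\mathcal C_X$ is the set of components of $G-X$; for $\mathcal C\subseteq\mathcal C_X$ let $V[\mathcal C]$ be the union of their vertex sets and $(X,\mathcal C):=(V\setminus V[\mathcal C],X\cup V[\mathcal C])$, $(\mathcal C,X)$ its inverse, $\{X,\mathcal C\}$ the separation (every separation can be written this way, with separator $X$). For $Y\subseteq X$ let $\mathcal C_X(Y)=\{C\in\mathcal C_X: N(C)=Y\}$. Tame: a finite-order separation $\{X,\mathcal C\}$ is tame if there is no $Y\subseteq X$ such that both $\mathcal C_X(Y)\cap\mathcal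 C$ and $\mathcal C_X(Y)\setminus\mathcal C$ are infinite. Orientations and tangles: an orientation of a set $S$ of separations is a set $O$ containing exactly one orientation of each separation in $S$; it is consistent if there are no two distinct $r,s\in S$ with orientations $\vec r<\vec s$ such that the inverse $\overleftarrow r$ and $\vec s$ both lie in $O$. A star is a set $\sigma$ of oriented separations with $\vec r\le\overleftarrow s$ for all distinct $\vec r,\vec s\in\sigma$; the interior of a star $\{(A_i,B_i)\}_i$ is $\bigcap_i B_i$. An $\aleph_0$-tangle of $G$ is a consistent orientation of $S_{\aleph_0}$ that contains no finite star with finite interior. For an $\aleph_0$-tangle $\tau$ and finite $X\subseteq V$, $U(\tau,X)=\{\mathcal C\subseteq\mathcal C_X:(X,\mathcal C)\in\tau\}$ is an ultrafilter on $\mathcal C_X$. $\tau$ is an ultrafilter tangle if $U(\tau,X)$ is free for some finite $X$; then there is a $\subseteq$-least such $X$, denoted $X_\tau$. An end $\omega$ of $G$ (class of rays, two rays equivalent if for every finite $X$ they have tails in the same component of $G-X$) gives the end tangle $\tau_\omega=\{(X,\mathcal C)\in\vec S_{\aleph_0}: C(X,\omega)\in\mathcal C\}$, where $C(X,\omega)$ is the component of $G-X$ containing tails of the rays of $\omega$. Every $\aleph_0$-tangle is an end tangle or an ultrafilter tangle. Two $\aleph_0$-tangles are equivalent if both are ultrafilter tangles with $X_{\tau_1}=X_{\tau_2}$; otherwise (in particular if one is an end tangle) they are inequivalent. A separation $\{A,B\}$ distinguishes $\tau_1,\tau_2$ if $(A,B)\in\tau_1,(B,A)\in\tau_2$ or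 vice versa, and does so efficiently if it has minimum order among all separations of $G$ distinguishing them. Tree sets: a set $T$ of separations is nested if every two of its separations have $\le$-comparable orientations. An oriented separation $\vec r$ of $T$ is degenerate if $\vec r=\overleftarrow r$ and trivial if there is $s\in T$, $s\ne r$, with $\vec r<\vec s$ and $\vec r<\overleftarrow s$. A tree set is a nested set of separations none of whose orientations is degenerate or trivial. *)

theory Defs
  imports Main
begin

text \<open>
  Graphs are simple, undirected and of arbitrary cardinality: a vertex set \<open>V\<close> and a set \<open>E\<close> of
  two-element subsets of \<open>V\<close>.
\<close>

definition simple_graph :: "'a set \<Rightarrow> 'a set set \<Rightarrow> bool" where
  "simple_graph V E \<longleftrightarrow> (\<forall>e\<in>E. e \<subseteq> V \<and> card e = 2)"

text \<open>Pairs of vertices in \<open>S\<close> joined by a path in the subgraph induced on \<open>S\<close>.\<close>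

definition linked :: "'a set set \<Rightarrow> 'a set \<Rightarrow> ('a \<times> 'a) set" where
  "linked E S = {(u, v). u \<in> S \<and> v \<in> S \<and> (u, v) \<in> {(x, y). x \<in> S \<and> y \<in> S \<and> {x, y} \<in> E}\<^sup>*}"

definition connected_graph :: "'a set \<Rightarrow> 'a set set \<Rightarrow> bool" where
  "connected_graph V E \<longleftrightarrow> (\<forall>u\<in>V. \<forall>v\<in>V. (u, v) \<in> linked E V)"

text \<open>The components of \<open>G - X\<close>, each given by its vertex set.\<close>

definition comps :: "'a set \<Rightarrow> 'a set set \<Rightarrow> 'a set \<Rightarrow> 'a set set" where
  "comps V E X = (V - X) // linked E (V - X)"

definition nbhd :: "'a set \<Rightarrow> 'a set set \<Rightarrow> 'a set \<Rightarrow> 'a set" where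
  "nbhd V E C = {v \<in> V - C. \<exists>u\<in>C. {u, v} \<in> E}"

definition comps_nbhd :: "'a set \<Rightarrow> 'a set set \<Rightarrow> 'a set \<Rightarrow> 'a set \<Rightarrow> 'a set set" where
  "comps_nbhd V E X Y = {C \<in> comps V E X. nbhd V E C = Y}"


section \<open>Separations\<close>

text \<open>
  A separation is an unordered pair, hence a set \<open>{A, B}\<close>; its separator is \<open>\<Inter>{A, B} = A \<inter> B\<close>.
  Its orientations are ordered pairs, and the inverse of \<open>p\<close> is \<open>prod.swap p\<close>.
\<close>

type_synonym 'a sep = "'a set set"
type_synonym 'a osep = "'a set \<times> 'a set"

definition separations :: "'a set \<Rightarrow> 'a set set \<Rightarrow> 'a sep set" where
  "separations V E =
     {{A, B} | A B. A \<union> B = V \<and> (\<forall>u \<in> A - B. \<forall>v \<in> B - A. {u, v} \<notin> E)}"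

definition fin_separations :: "'a set \<Rightarrow> 'a set set \<Rightarrow> 'a sep set" where
  "fin_separations V E = {s \<in> separations V E. finite (\<Inter>s)}"

fun underlying :: "'a osep \<Rightarrow> 'a sep" where
  "underlying (A, B) = {A, B}"

definition orientations :: "'a sep set \<Rightarrow> 'a osep set" where
  "orientations S = {p. underlying p \<in> S}"

fun osep_le :: "'a osep \<Rightarrow> 'a osep \<Rightarrow> bool" where
  "osep_le (A, B) (C, D) \<longleftrightarrow> A \<subseteq> C \<and> B \<supseteq> D"

definition osep_less :: "'a osep \<Rightarrow> 'a osep \<Rightarrow> bool" where
  "osep_less p q \<longleftrightarrow> osep_le p q \<and> p \<noteq> q"

text \<open>The oriented separation \<open>(X, \<C>)\<close> for a set \<open>\<C>\<close> of components of \<open>G - X\<close>.\<close>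

definition comp_sep :: "'a set \<Rightarrow> 'a set \<Rightarrow> 'a set set \<Rightarrow> 'a osep" where
  "comp_sep V X \<C> = (V - \<Union>\<C>, X \<union> \<Union>\<C>)"

text \<open>
  In \<open>s = {X, \<C>}\<close> the set \<open>X\<close> is determined by \<open>s\<close>, and \<open>\<C>\<close> up to complementation in the set of
  components of \<open>G - X\<close>. The condition on \<open>Y\<close> is invariant under this complementation, so the
  choice of \<open>\<C>\<close> does not matter.
\<close>

definition tame :: "'a set \<Rightarrow> 'a set set \<Rightarrow> 'a sep \<Rightarrow> bool" where
  "tame V E s \<longleftrightarrow> s \<in> fin_separations V E \<and>
     (\<exists>X \<C>. X \<subseteq> V \<and> \<C> \<subseteq> comps V E X \<and> s = underlying (comp_sep V X \<C>) \<and>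
        \<not> (\<exists>Y\<subseteq>X. infinite (comps_nbhd V E X Y \<inter> \<C>) \<and> infinite (comps_nbhd V E X Y - \<C>)))"


section \<open>Tangles\<close>

definition orientation_of :: "'a sep set \<Rightarrow> 'a osep set \<Rightarrow> bool" where
  "orientation_of S O' \<longleftrightarrow>
     O' \<subseteq> orientations S \<and> (\<forall>s\<in>S. \<exists>!p. p \<in> O' \<and> underlying p = s)"

definition consistent :: "'a sep set \<Rightarrow> 'a osep set \<Rightarrow> bool" where
  "consistent S O' \<longleftrightarrow>
     \<not> (\<exists>p q. underlying p \<in> S \<and> underlying q \<in> S \<and> underlying p \<noteq> underlying q \<and>
          osep_less p q \<and> prod.swap p \<in> O' \<and> q \<in> O')"

definition osep_star :: "'a osep set \<Rightarrow> bool" where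
  "osep_star \<sigma> \<longleftrightarrow> (\<forall>p\<in>\<sigma>. \<forall>q\<in>\<sigma>. p \<noteq> q \<longrightarrow> osep_le p (prod.swap q))"

text \<open>Intersecting with \<open>V\<close> only affects the empty star, whose interior is \<open>V\<close>.\<close>

definition star_interior :: "'a set \<Rightarrow> 'a osep set \<Rightarrow> 'a set" where
  "star_interior V \<sigma> = V \<inter> (\<Inter>p\<in>\<sigma>. snd p)"

definition aleph0_tangle :: "'a set \<Rightarrow> 'a set set \<Rightarrow> 'a osep set \<Rightarrow> bool" where
  "aleph0_tangle V E \<tau> \<longleftrightarrow>
     orientation_of (fin_separations V E) \<tau> \<and>
     consistent (fin_separations V E) \<tau> \<and>
     \<not> (\<exists>\<sigma>\<subseteq>\<tau>. finite \<sigma> \<and> osep_star \<sigma> \<and> finite (star_interior V \<sigma>))"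

definition ultrafilter_on :: "'b set \<Rightarrow> 'b set set \<Rightarrow> bool" where
  "ultrafilter_on \<Omega> \<U> \<longleftrightarrow>
     \<U> \<subseteq> Pow \<Omega> \<and> \<Omega> \<in> \<U> \<and> {} \<notin> \<U> \<and>
     (\<forall>\<A>\<in>\<U>. \<forall>\<B>\<in>\<U>. \<A> \<inter> \<B> \<in> \<U>) \<and>
     (\<forall>\<A>\<in>\<U>. \<forall>\<B>\<subseteq>\<Omega>. \<A> \<subseteq> \<B> \<longrightarrow> \<B> \<in> \<U>) \<and>
     (\<forall>\<A>\<subseteq>\<Omega>. \<A> \<in> \<U> \<or> \<Omega> - \<A> \<in> \<U>)"

definition free_ultrafilter_on :: "'b set \<Rightarrow> 'b set set \<Rightarrow> bool" where
  "free_ultrafilter_on \<Omega> \<U> \<longleftrightarrow> ultrafilter_on \<Omega> \<U> \<and> \<Inter>\<U> = {}"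

definition tangle_ultrafilter ::
    "'a set \<Rightarrow> 'a set set \<Rightarrow> 'a osep set \<Rightarrow> 'a set \<Rightarrow> 'a set set set" where
  "tangle_ultrafilter V E \<tau> X = {\<C>. \<C> \<subseteq> comps V E X \<and> comp_sep V X \<C> \<in> \<tau>}"

definition free_at :: "'a set \<Rightarrow> 'a set set \<Rightarrow> 'a osep set \<Rightarrow> 'a set \<Rightarrow> bool" where
  "free_at V E \<tau> X \<longleftrightarrow> finite X \<and> X \<subseteq> V \<and>
     free_ultrafilter_on (comps V E X) (tangle_ultrafilter V E \<tau> X)"

definition ultrafilter_tangle :: "'a set \<Rightarrow> 'a set set \<Rightarrow> 'a osep set \<Rightarrow> bool" where
  "ultrafilter_tangle V E \<tau> \<longleftrightarrow> aleph0_tangle V E \<tau> \<and> (\<exists>X. free_at V E \<tau> X)"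

text \<open>The least such set with respect to inclusion.\<close>

definition X_of :: "'a set \<Rightarrow> 'a set set \<Rightarrow> 'a osep set \<Rightarrow> 'a set" where
  "X_of V E \<tau> = (LEAST X. free_at V E \<tau> X)"

definition equivalent_tangles ::
    "'a set \<Rightarrow> 'a set set \<Rightarrow> 'a osep set \<Rightarrow> 'a osep set \<Rightarrow> bool" where
  "equivalent_tangles V E \<tau>\<^sub>1 \<tau>\<^sub>2 \<longleftrightarrow>
     ultrafilter_tangle V E \<tau>\<^sub>1 \<and> ultrafilter_tangle V E \<tau>\<^sub>2 \<and> X_of V E \<tau>\<^sub>1 = X_of V E \<tau>\<^sub>2"

definition distinguishes :: "'a sep \<Rightarrow> 'a osep set \<Rightarrow> 'a osep set \<Rightarrow> bool" where
  "distinguishes s \<tau>\<^sub>1 \<tau>\<^sub>2 \<longleftrightarrow> (\<exists>A B. s = {A, B} \<and>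
     ((A, B) \<in> \<tau>\<^sub>1 \<and> (B, A) \<in> \<tau>\<^sub>2 \<or> (B, A) \<in> \<tau>\<^sub>1 \<and> (A, B) \<in> \<tau>\<^sub>2))"

text \<open>
  Tangles orient only separations of finite order, so every separation distinguishing two of them
  has a finite separator and \<^const>\<open>card\<close> is its true order.
\<close>

definition efficiently_distinguishes ::
    "'a set \<Rightarrow> 'a set set \<Rightarrow> 'a sep \<Rightarrow> 'a osep set \<Rightarrow> 'a osep set \<Rightarrow> bool" where
  "efficiently_distinguishes V E s \<tau>\<^sub>1 \<tau>\<^sub>2 \<longleftrightarrow>
     s \<in> separations V E \<and> distinguishes s \<tau>\<^sub>1 \<tau>\<^sub>2 \<and>
     (\<forall>s'\<in>separations V E. distinguishes s' \<tau>\<^sub>1 \<tau>\<^sub>2 \<longrightarrow> card (\<Inter>s) \<le> card (\<Inter>s'))"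


section \<open>Tree sets\<close>

definition nested :: "'a sep set \<Rightarrow> bool" where
  "nested T \<longleftrightarrow> (\<forall>r\<in>T. \<forall>s\<in>T. \<exists>p q. underlying p = r \<and> underlying q = s \<and>
     (osep_le p q \<or> osep_le q p))"

definition degenerate :: "'a osep \<Rightarrow> bool" where
  "degenerate p \<longleftrightarrow> p = prod.swap p"

definition trivial_in :: "'a sep set \<Rightarrow> 'a osep \<Rightarrow> bool" where
  "trivial_in T p \<longleftrightarrow> (\<exists>q. underlying q \<in> T \<and> underlying q \<noteq> underlying p \<and>
     osep_less p q \<and> osep_less p (prod.swap q))"

definition tree_set :: "'a sep set \<Rightarrow> bool" where
  "tree_set T \<longleftrightarrow> nested T \<and> (\<forall>p\<in>orientations T. \<not> degenerate p \<and> \<not> trivial_in T p)"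

end

theory Submission
  imports Defs
begin

text \<open>
  A tangle is treated as an ultrafilter on the vertex sets with finite neighbourhood. If a finite \<open>X\<close>
  is a smallest separator distinguishing two tangles, then both tangles live in components of \<open>G - X\<close>
  with neighbourhood \<open>X\<close> (otherwise a proper subset of \<open>X\<close> would do), and if the tangles are
  inequivalent, then one of them lives in a single such component \<open>C\<close>. So \<open>X\<close> is tight: at least two
  components of \<open>G - X\<close> have neighbourhood \<open>X\<close>.

  Call \<open>X\<close> and \<open>Y\<close> nested if \<open>Y\<close> meets at most one component of \<open>G - X\<close>. Only finitely many tight
  separators of given order cross a given one, since each of them separates two of its vertices.
  Submodularity turns crossing efficient separators into opposite corners that are again efficient and
  have fewer crossings in total. Choosing separators with fewest crossings, order by order, therefore
  gives a nested set of tight separators that efficiently distinguishes all inequivalent tangles.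

  It remains to choose sides. Fix a well-ordering of the vertices, and for each \<open>X\<close> let the root be the
  component with neighbourhood \<open>X\<close> that contains the first possible vertex. The separations cut off,
  at \<open>X\<close>, either one component with neighbourhood \<open>X\<close> other than the root, or all of these. They are
  tame, and nested whenever their separators are.
\<close>

section \<open>Components\<close>

text \<open>A family of infinitely many separators has to be uncrossed, and one separator may cross
  infinitely many others, so no global count of crossings can be minimised. Only the crossings with
  separators of one fixed order are finite in number. Hence lower orders enter as a constraint that
  can always be met, higher orders are ignored, and the minimised count compares separators of equal
  order only. Crossing is measured between separators, not between separations, so that the choice
  of sides can wait until the end. The obstacle is that a side made of many components may have
  corners whose separators spread over many components of \<open>G - X\<close>. Inequivalence
  removes it: one side can be taken to be a single full component \<open>C\<close>, and then every
  corner separator lies in \<open>X \<union> C\<close> or avoids \<open>C\<close>. The same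
  component \<open>C\<close> decides the final sides: a single component or all full components but
  one, hence a finite or a cofinite set of full components, which is what tameness asks for.\<close>

lemma linked_refl: "u \<in> S \<Longrightarrow> (u, u) \<in> linked E S"
  by (simp add: linked_def)

lemma linked_sym:
  assumes "(u, v) \<in> linked E S"
  shows "(v, u) \<in> linked E S"
proof -
  have "sym ({(x, y). x \<in> S \<and> y \<in> S \<and> {x, y} \<in> E}\<^sup>*)"
    by (rule sym_rtrancl) (auto simp: sym_def insert_commute)
  then show ?thesis
    using assms by (auto simp: linked_def dest: symD)
qed

lemma linked_trans:
  "(u, v) \<in> linked E S \<Longrightarrow> (v, w) \<in> linked E S \<Longrightarrow> (u, w) \<in> linked E S"
  by (auto simp: linked_def)

lemma linked_mono:
  assumes "S \<subseteq> S'"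
  shows "linked E S \<subseteq> linked E S'"
proof -
  have "{(x, y). x \<in> S \<and> y \<in> S \<and> {x, y} \<in> E}\<^sup>* \<subseteq> {(x, y). x \<in> S' \<and> y \<in> S' \<and> {x, y} \<in> E}\<^sup>*"
    using assms by (intro rtrancl_mono) auto
  then show ?thesis
    using assms by (auto simp: linked_def)
qed

lemma linked_edge: "u \<in> S \<Longrightarrow> v \<in> S \<Longrightarrow> {u, v} \<in> E \<Longrightarrow> (u, v) \<in> linked E S"
  by (auto simp: linked_def)

lemma linked_induct [consumes 1, case_names refl step]:
  assumes "(u, v) \<in> linked E S"
    and "P u"
    and "\<And>x y. (u, x) \<in> linked E S \<Longrightarrow> x \<in> S \<Longrightarrow> y \<in> S \<Longrightarrow> {x, y} \<in> E \<Longrightarrow> P x \<Longrightarrow> P y"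
  shows "P v"
proof -
  have uS: "u \<in> S" and "(u, v) \<in> {(x, y). x \<in> S \<and> y \<in> S \<and> {x, y} \<in> E}\<^sup>*"
    using assms(1) by (auto simp: linked_def)
  from this(2) show ?thesis
  proof (induction rule: rtrancl_induct)
    case base
    show ?case by (fact assms(2))
  next
    case (step x y)
    then show ?case
      using uS assms(3)[of x y] by (auto simp: linked_def)
  qed
qed

text \<open>The general form of the fact that a path cannot leave a set without crossing its
  boundary. Components trap connected sets through it, with \<open>U\<close> a component or a union
  of components.\<close>

lemma linked_closed:
  assumes "(u, v) \<in> linked E S" "u \<in> U"
    and "\<And>x y. x \<in> U \<Longrightarrow> y \<in> S \<Longrightarrow> {x, y} \<in> E \<Longrightarrow> y \<in> U"
  shows "(u, v) \<in> linked E U"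
  using assms(1)
proof (induction rule: linked_induct)
  case refl
  show ?case using assms(2) by (rule linked_refl)
next
  case (step x y)
  then have "x \<in> U" by (simp add: linked_def)
  with step assms(3) have "(x, y) \<in> linked E U"
    by (intro linked_edge) auto
  with step show ?case by (blast intro: linked_trans)
qed

text \<open>Provides a finite set that every separator of \<open>u\<close> and \<open>v\<close> has
  to meet; this is what makes the branching over separators finite later on.\<close>

lemma linked_finite:
  assumes "(u, v) \<in> linked E S"
  shows "\<exists>P\<subseteq>S. finite P \<and> (u, v) \<in> linked E P"
  using assms
proof (induction rule: linked_induct)
  case refl
  have "u \<in> S" using assms by (simp add: linked_def)
  then show ?case by (intro exI[of _ "{u}"]) (auto intro: linked_refl)
next
  case (step x y)
  then obtain P where P: "P \<subseteq> S" "finite P" "(u, x) \<in> linked E P" by blast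
  have "x \<in> P" using P(3) by (simp add: linked_def)
  then have "(x, y) \<in> linked E (insert y P)"
    using step by (intro linked_edge) auto
  moreover have "(u, x) \<in> linked E (insert y P)"
    using P(3) linked_mono[of P "insert y P"] by blast
  ultimately have "(u, y) \<in> linked E (insert y P)"
    by (blast intro: linked_trans)
  with P step show ?case by (intro exI[of _ "insert y P"]) auto
qed

lemma connected_graphI:
  assumes "\<And>v. v \<in> S \<Longrightarrow> (u, v) \<in> linked E S"
  shows "connected_graph S E"
  unfolding connected_graph_def using assms by (blast intro: linked_sym linked_trans)

text \<open>An intrinsic description in which \<open>X\<close> occurs only as a set that
  \<open>C\<close> avoids and that contains its neighbourhood. The same \<open>C\<close> is
  therefore a component for many separators at once, in particular for its own
  neighbourhood.\<close>

lemma comps_iff: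
  "C \<in> comps V E X \<longleftrightarrow> C \<noteq> {} \<and> C \<subseteq> V - X \<and> connected_graph C E \<and> nbhd V E C \<subseteq> X"
proof
  assume "C \<in> comps V E X"
  then obtain u where u: "u \<in> V - X" and C: "C = linked E (V - X) `` {u}"
    by (auto simp: comps_def quotient_def)
  have uC: "u \<in> C" using u C by (auto intro: linked_refl)
  have CV: "C \<subseteq> V - X" using C by (auto simp: linked_def)
  have closed: "y \<in> C" if "x \<in> C" "y \<in> V - X" "{x, y} \<in> E" for x y
  proof -
    have "(x, y) \<in> linked E (V - X)" using that CV by (intro linked_edge) auto
    then show ?thesis using that(1) C by (auto intro: linked_trans)
  qed
  have "connected_graph C E"
  proof (rule connected_graphI)
    fix v assume "v \<in> C"
    then have "(u, v) \<in> linked E (V - X)" using C by simp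
    then show "(u, v) \<in> linked E C" using uC closed by (rule linked_closed)
  qed
  moreover have "nbhd V E C \<subseteq> X"
    using closed by (auto simp: nbhd_def)
  ultimately show "C \<noteq> {} \<and> C \<subseteq> V - X \<and> connected_graph C E \<and> nbhd V E C \<subseteq> X"
    using uC CV by auto
next
  assume C: "C \<noteq> {} \<and> C \<subseteq> V - X \<and> connected_graph C E \<and> nbhd V E C \<subseteq> X"
  then obtain u where u: "u \<in> C" by auto
  have "(u, v) \<in> linked E C" if "(u, v) \<in> linked E (V - X)" for v
    using that u by (rule linked_closed) (use C in \<open>auto simp: nbhd_def\<close>)
  moreover have "(u, v) \<in> linked E (V - X)" if "v \<in> C" for v
    using that u C linked_mono[of C "V - X" E] by (auto simp: connected_graph_def)
  moreover have "v \<in> C" if "(u, v) \<in> linked E C" for v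
    using that by (simp add: linked_def)
  ultimately have "C = linked E (V - X) `` {u}"
    by blast
  then show "C \<in> comps V E X"
    using u C by (auto simp: comps_def quotient_def)
qed

lemma comps_cover:
  assumes "v \<in> V - X"
  shows "\<exists>K\<in>comps V E X. v \<in> K"
proof
  show "linked E (V - X) `` {v} \<in> comps V E X"
    unfolding comps_def using assms by (rule quotientI)
  show "v \<in> linked E (V - X) `` {v}"
    using linked_refl[OF assms] by blast
qed

lemma connected_subset_comp:
  assumes "connected_graph S E" "S \<subseteq> V" "S \<inter> X = {}" "K \<in> comps V E X" "S \<inter> K \<noteq> {}"
  shows "S \<subseteq> K"
proof
  fix v assume v: "v \<in> S"
  obtain u where u: "u \<in> S" "u \<in> K" using assms by blast
  then have "(u, v) \<in> linked E S" using v assms by (auto simp: connected_graph_def)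
  then have "(u, v) \<in> linked E K"
    by (rule linked_closed) (use u assms in \<open>auto simp: comps_iff nbhd_def\<close>)
  then show "v \<in> K" by (simp add: linked_def)
qed

lemma connected_in_comp:
  assumes "connected_graph S E" "S \<subseteq> V" "S \<inter> X = {}" "S \<noteq> {}"
  shows "\<exists>K\<in>comps V E X. S \<subseteq> K"
proof -
  obtain v where v: "v \<in> S" using assms(4) by blast
  then have "v \<in> V - X" using assms(2,3) by blast
  from comps_cover[OF this, of E] obtain K where K: "K \<in> comps V E X" "v \<in> K" ..
  then have "S \<subseteq> K"
    using v by (intro connected_subset_comp[OF assms(1-3) K(1)]) blast
  with K(1) show ?thesis ..
qed

lemma comps_eqI:
  assumes "K \<in> comps V E X" "K' \<in> comps V E X" "K \<inter> K' \<noteq> {}"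
  shows "K = K'"
proof
  have K: "connected_graph K E" "K \<subseteq> V" "K \<inter> X = {}"
    and K': "connected_graph K' E" "K' \<subseteq> V" "K' \<inter> X = {}"
    using assms(1,2) unfolding comps_iff by blast+
  show "K \<subseteq> K'"
    using connected_subset_comp[OF K assms(2,3)] .
  show "K' \<subseteq> K"
    using connected_subset_comp[OF K' assms(1)] assms(3) by (simp add: Int_commute)
qed

lemma connected_extend:
  assumes "connected_graph S E" "R \<subseteq> nbhd V E S" "S \<noteq> {}"
  shows "connected_graph (S \<union> R) E"
proof -
  obtain u where u: "u \<in> S" using assms(3) by blast
  have S: "(u, v) \<in> linked E (S \<union> R)" if "v \<in> S" for v
    using that u assms(1) linked_mono[of S "S \<union> R" E] by (auto simp: connected_graph_def)
  show ?thesis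
  proof (rule connected_graphI)
    fix v assume v: "v \<in> S \<union> R"
    show "(u, v) \<in> linked E (S \<union> R)"
    proof (cases "v \<in> S")
      case False
      then obtain w where w: "w \<in> S" "{w, v} \<in> E"
        using v assms(2) by (auto simp: nbhd_def)
      then have "(w, v) \<in> linked E (S \<union> R)"
        using v by (intro linked_edge) auto
      then show ?thesis using S[OF w(1)] by (blast intro: linked_trans)
    qed (rule S)
  qed
qed

section \<open>Components attached to the whole separator\<close>

abbreviation full_comps :: "'a set \<Rightarrow> 'a set set \<Rightarrow> 'a set \<Rightarrow> 'a set set" where
  "full_comps V E X \<equiv> comps_nbhd V E X X"

lemma full_comps_iff:
  "C \<in> full_comps V E X \<longleftrightarrow> C \<noteq> {} \<and> C \<subseteq> V - X \<and> connected_graph C E \<and> nbhd V E C = X"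
  by (auto simp: comps_nbhd_def comps_iff)

lemma comps_nbhd_full: "C \<in> comps_nbhd V E X Y \<Longrightarrow> C \<in> full_comps V E Y"
  by (auto simp: comps_nbhd_def comps_iff nbhd_def)

lemma full_comps_comps: "C \<in> full_comps V E X \<Longrightarrow> C \<in> comps V E X"
  by (simp add: comps_nbhd_def)

text \<open>Every vertex of \<open>X\<close> has a neighbour in \<open>C\<close>, so
  \<open>C \<union> (X - Y)\<close> is connected and disjoint from \<open>Y\<close>. All nestedness
  below is obtained from this.\<close>

lemma full_comp_avoiding:
  assumes "C \<in> full_comps V E X" "C \<inter> Y = {}"
  shows "\<exists>L\<in>comps V E Y. C \<union> (X - Y) \<subseteq> L"
proof (rule connected_in_comp)
  show "connected_graph (C \<union> (X - Y)) E"
    by (rule connected_extend[where V = V]) (use assms in \<open>auto simp: full_comps_iff\<close>)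
  show "C \<union> (X - Y) \<subseteq> V" "(C \<union> (X - Y)) \<inter> Y = {}" "C \<union> (X - Y) \<noteq> {}"
    using assms by (auto simp: full_comps_iff nbhd_def)
qed

section \<open>Tight separators\<close>

definition tight :: "'a set \<Rightarrow> 'a set set \<Rightarrow> 'a set \<Rightarrow> bool" where
  "tight V E X \<longleftrightarrow> finite X \<and> (\<exists>C\<in>full_comps V E X. \<exists>C'\<in>full_comps V E X. C \<noteq> C')"

definition nest :: "'a set \<Rightarrow> 'a set set \<Rightarrow> 'a set \<Rightarrow> 'a set \<Rightarrow> bool" where
  "nest V E X Y \<longleftrightarrow> (\<exists>K\<in>comps V E X. Y \<subseteq> X \<union> K)"

lemma tight_other:
  assumes "tight V E X"
  shows "\<exists>C\<in>full_comps V E X. C \<noteq> K"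
  using assms unfolding tight_def by blast

lemma nest_if_full_comp_avoids:
  assumes "C \<in> full_comps V E X" "C \<inter> Y = {}"
  shows "nest V E Y X"
  using full_comp_avoiding[OF assms] unfolding nest_def by blast

text \<open>Tightness supplies a full component of \<open>G - X\<close> other than the one that may
  contain vertices of \<open>Y\<close>; it avoids \<open>Y\<close> and ties \<open>X - Y\<close>
  together.\<close>

lemma nest_sym:
  assumes "tight V E X" "nest V E X Y"
  shows "nest V E Y X"
proof -
  obtain K where K: "K \<in> comps V E X" "Y \<subseteq> X \<union> K"
    using assms by (auto simp: nest_def)
  obtain C where C: "C \<in> full_comps V E X" "C \<noteq> K"
    using tight_other[OF assms(1)] by blast
  have "C \<inter> K = {}"
    using comps_eqI[OF full_comps_comps[OF C(1)] K(1)] C by blast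
  then have "C \<inter> Y = {}"
    using K C by (auto simp: full_comps_iff)
  then show ?thesis by (rule nest_if_full_comp_avoids[OF C(1)])
qed

lemma nest_refl: "tight V E X \<Longrightarrow> nest V E X X"
  by (auto simp: nest_def tight_def dest: full_comps_comps)

text \<open>A full component \<open>C\<close> of \<open>G - X\<close> away from \<open>W\<close> is
  tied to all of \<open>X - W\<close>, and it meets \<open>Y\<close> because \<open>X\<close> and
  \<open>Y\<close> cross. As \<open>C\<close> avoids \<open>W\<close>, the components of
  \<open>G - W\<close> holding the rest of \<open>X\<close> and the rest of \<open>Y\<close>
  coincide. So a separator nested with two crossing ones cannot come between them.\<close>

lemma nest_crossing_Un:
  assumes "tight V E X" "tight V E W" "\<not> nest V E Y X" "nest V E W X" "nest V E W Y"
  shows "\<exists>H\<in>comps V E W. X \<union> Y \<subseteq> W \<union> H"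
proof -
  obtain H where H: "H \<in> comps V E W" "X \<subseteq> W \<union> H"
    using assms by (auto simp: nest_def)
  obtain H' where H': "H' \<in> comps V E W" "Y \<subseteq> W \<union> H'"
    using assms by (auto simp: nest_def)
  show ?thesis
  proof (cases "X \<subseteq> W")
    case True
    with H' show ?thesis by blast
  next
    case False
    obtain K where K: "K \<in> comps V E X" "W \<subseteq> X \<union> K"
      using nest_sym[OF assms(2,4)] by (auto simp: nest_def)
    obtain C where C: "C \<in> full_comps V E X" "C \<noteq> K"
      using tight_other[OF assms(1)] by blast
    have "C \<inter> K = {}"
      using comps_eqI[OF full_comps_comps[OF C(1)] K(1)] C by blast
    then have CW: "C \<inter> W = {}"
      using K C by (auto simp: full_comps_iff)
    have CY: "C \<inter> Y \<noteq> {}"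
      using nest_if_full_comp_avoids[OF C(1)] assms by blast
    obtain L where L: "L \<in> comps V E W" "C \<union> (X - W) \<subseteq> L"
      using full_comp_avoiding[OF C(1) CW] by blast
    have "L = H"
      using L H False by (intro comps_eqI[of L V E W H]) auto
    moreover have "L = H'"
    proof (rule comps_eqI[OF L(1) H'(1)])
      show "L \<inter> H' \<noteq> {}" using L(2) H'(2) CY CW by blast
    qed
    ultimately show ?thesis using H H' by blast
  qed
qed

section \<open>Local finiteness of crossings\<close>

lemma finite_separators_through:
  assumes "finite U"
  shows "finite {W. U \<subseteq> W \<and> finite W \<and> card (W - U) = k \<and>
    (\<exists>D\<in>full_comps V E W. \<exists>D'\<in>full_comps V E W. D \<noteq> D' \<and> x \<in> D \<and> x' \<in> D')}" (is "finite (?S U k)")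
  using assms
proof (induction k arbitrary: U)
  case 0
  have "?S U 0 \<subseteq> {U}" by auto
  then show ?case by (rule finite_subset) simp
next
  case (Suc k)
  show ?case
  proof (cases "?S U (Suc k) = {}")
    case True
    then show ?thesis by (simp only: finite.emptyI)
  next
    case False
    then obtain W D D' where W: "U \<subseteq> W" "card (W - U) = Suc k"
      and D: "D \<in> full_comps V E W" "D' \<in> full_comps V E W" "x \<in> D" "x' \<in> D'" by blast
    \<comment> \<open>A single member \<open>W\<close> of the family already shows that
      \<open>x\<close> and \<open>x'\<close> are joined in \<open>G - U\<close>: both reach
      \<open>w\<close> through full components of \<open>G - W\<close>, which avoid
      \<open>U \<subseteq> W\<close>.\<close>
    obtain w where w: "w \<in> W - U" using W(2) by (metis card_eq_SucD insertI1)
    have "connected_graph (D \<union> {w}) E" "connected_graph (D' \<union> {w}) E"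
      by (rule connected_extend[where V = V]; use D w in \<open>auto simp: full_comps_iff\<close>)+
    then have xw: "(x, w) \<in> linked E (D \<union> {w})" "(w, x') \<in> linked E (D' \<union> {w})"
      using D by (auto simp: connected_graph_def)
    have sub: "D \<union> {w} \<subseteq> V - U" "D' \<union> {w} \<subseteq> V - U"
      using D w W by (auto simp: full_comps_iff nbhd_def)
    have "(x, x') \<in> linked E (V - U)"
      by (rule linked_trans) (rule subsetD[OF linked_mono[OF sub(1)] xw(1)],
        rule subsetD[OF linked_mono[OF sub(2)] xw(2)])
    then obtain P where P: "P \<subseteq> V - U" "finite P" "(x, x') \<in> linked E P"
      by (blast dest: linked_finite)
    \<comment> \<open>Every member of the family separates \<open>x\<close> from \<open>x'\<close>,
      so it meets the finite set \<open>P\<close> outside \<open>U\<close>. Adding such a vertex to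
      \<open>U\<close> lowers the number of missing vertices by one.\<close>
    have "?S U (Suc k) \<subseteq> (\<Union>v\<in>P. ?S (insert v U) k)"
    proof
      fix W assume "W \<in> ?S U (Suc k)"
      then obtain D D' where W: "U \<subseteq> W" "finite W" "card (W - U) = Suc k"
        and D: "D \<in> full_comps V E W" "D' \<in> full_comps V E W" "D \<noteq> D'" "x \<in> D" "x' \<in> D'"
        by blast
      have "P \<inter> W \<noteq> {}"
      proof
        assume "P \<inter> W = {}"
        then have "(x, x') \<in> linked E (V - W)"
          using P linked_mono[of P "V - W" E] by blast
        then have "(x, x') \<in> linked E D"
          by (rule linked_closed) (use D in \<open>auto simp: full_comps_iff nbhd_def\<close>)
        then have "x' \<in> D" by (simp add: linked_def)
        then show False
          using comps_eqI[of D V E W D'] D by (blast dest: full_comps_comps)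
      qed
      then obtain v where v: "v \<in> P" "v \<in> W" by blast
      have "W - U = insert v (W - insert v U)" using v P by auto
      then have "card (W - U) = Suc (card (W - insert v U))"
        using W(2) by (metis DiffD2 card_insert_disjoint finite_Diff insertI1)
      then have "card (W - insert v U) = k" using W(3) by simp
      then have "W \<in> ?S (insert v U) k" using W D v by blast
      then show "W \<in> (\<Union>v\<in>P. ?S (insert v U) k)" using v by blast
    qed
    moreover have "finite (\<Union>v\<in>P. ?S (insert v U) k)"
      by (intro finite_UN_I[OF P(2)] Suc.IH finite.insertI Suc.prems)
    ultimately show ?thesis by (rule finite_subset)
  qed
qed

text \<open>If \<open>W\<close> crosses \<open>X\<close>, each full component of
  \<open>G - W\<close> meets \<open>X\<close>. Two of them thus contain vertices of \<open>X\<close>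
  that \<open>W\<close> separates, and \<open>X\<close> has only finitely many pairs of
  vertices.\<close>

lemma finite_crossing:
  assumes "tight V E X"
  shows "finite {W. tight V E W \<and> card W = k \<and> \<not> nest V E W X}"
proof -
  let ?S = "\<lambda>x x'. {W. {} \<subseteq> W \<and> finite W \<and> card (W - {}) = k \<and>
    (\<exists>D\<in>full_comps V E W. \<exists>D'\<in>full_comps V E W. D \<noteq> D' \<and> x \<in> D \<and> x' \<in> D')}"
  have "{W. tight V E W \<and> card W = k \<and> \<not> nest V E W X} \<subseteq> (\<Union>x\<in>X. \<Union>x'\<in>X. ?S x x')"
  proof
    fix W assume "W \<in> {W. tight V E W \<and> card W = k \<and> \<not> nest V E W X}"
    then have W: "tight V E W" "card W = k" "\<not> nest V E W X" by blast+
    then have meets: "D \<inter> X \<noteq> {}" if "D \<in> full_comps V E W" for D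
      using W(3) nest_if_full_comp_avoids[OF that] nest_sym[OF assms] by metis
    obtain D D' where D: "D \<in> full_comps V E W" "D' \<in> full_comps V E W" "D \<noteq> D'"
      using W by (auto simp: tight_def)
    obtain x x' where x: "x \<in> D" "x \<in> X" "x' \<in> D'" "x' \<in> X"
      using meets[OF D(1)] meets[OF D(2)] by blast
    have "W \<in> ?S x x'"
      using W(1,2) D x unfolding tight_def by auto
    then show "W \<in> (\<Union>x\<in>X. \<Union>x'\<in>X. ?S x x')"
      using x by blast
  qed
  moreover have "finite (\<Union>x\<in>X. \<Union>x'\<in>X. ?S x x')"
    using assms by (intro finite_UN_I finite_separators_through) (auto simp: tight_def)
  ultimately show ?thesis by (rule finite_subset)
qed

section \<open>Choosing elements with few crossings\<close>

text \<open>Level \<open>k\<close> consists of elements of order below \<open>k\<close>. All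
  minimisers are added for every index, so no choice is made, at the price that even two minimisers
  for the same index have to be shown nested.\<close>

primrec splinter_levels ::
    "('x \<Rightarrow> 'x \<Rightarrow> bool) \<Rightarrow> ('x \<Rightarrow> nat) \<Rightarrow> ('i \<Rightarrow> 'x set) \<Rightarrow> nat \<Rightarrow> 'x set" where
  "splinter_levels R ord A 0 = {}"
| "splinter_levels R ord A (Suc k) = splinter_levels R ord A k \<union>
     {x. \<exists>i. is_arg_min (\<lambda>x. card {w \<in> \<Union>(range A). ord w = k \<and> \<not> R w x})
        (\<lambda>x. x \<in> A i \<and> ord x = k \<and> (\<forall>w\<in>splinter_levels R ord A k. R w x)) x}"

text \<open>Abstract form of the selection, with \<open>R\<close> for nestedness and
  \<open>A i\<close> for the candidates of index \<open>i\<close>. The second outcome of uncrossing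
  covers two elements that are both candidates for both indices: there the corners may serve
  \<open>i\<close> only, and this is compensated by exchanging \<open>x\<close> and
  \<open>y\<close>.\<close>

lemma splinter:
  fixes R :: "'x \<Rightarrow> 'x \<Rightarrow> bool" and ord :: "'x \<Rightarrow> nat" and A :: "'i \<Rightarrow> 'x set"
  assumes ord_eq: "\<And>i x y. x \<in> A i \<Longrightarrow> y \<in> A i \<Longrightarrow> ord x = ord y"
    and R_refl: "\<And>i x. x \<in> A i \<Longrightarrow> R x x"
    and R_sym: "\<And>i j x y. x \<in> A i \<Longrightarrow> y \<in> A j \<Longrightarrow> R x y \<Longrightarrow> R y x"
    and fin: "\<And>i x k. x \<in> A i \<Longrightarrow> finite {w \<in> \<Union>(range A). ord w = k \<and> \<not> R w x}"
    and uncross: "\<And>i j x y. x \<in> A i \<Longrightarrow> y \<in> A j \<Longrightarrow> ord y \<le> ord x \<Longrightarrow> \<not> R x y \<Longrightarrow>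
      \<exists>c d. (\<forall>w\<in>\<Union>(range A). R w x \<and> R w y \<longrightarrow> R w c \<and> R w d) \<and>
            (\<forall>w\<in>\<Union>(range A). R w x \<or> R w y \<longrightarrow> R w c \<or> R w d) \<and>
            R x c \<and> R x d \<and> R y c \<and> R y d \<and>
            (c \<in> A i \<and> d \<in> A j \<or> ord x = ord y \<and> c \<in> A i \<and> d \<in> A i \<and> y \<in> A i \<and> x \<in> A j)"
  shows "\<exists>N\<subseteq>\<Union>(range A). (\<forall>x\<in>N. \<forall>y\<in>N. R x y) \<and> (\<forall>i. A i \<noteq> {} \<longrightarrow> N \<inter> A i \<noteq> {})"
proof -
  define L where "L = splinter_levels R ord A"
  define cr where "cr k x = card {w \<in> \<Union>(range A). ord w = k \<and> \<not> R w x}" for k x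
  define Q where "Q k i x \<longleftrightarrow> x \<in> A i \<and> ord x = k \<and> (\<forall>w\<in>L k. R w x)" for k i x
  have L_0: "L 0 = {}" by (simp add: L_def)
  have L_Suc: "L (Suc k) = L k \<union> {x. \<exists>i. is_arg_min (cr k) (Q k i) x}" for k
    unfolding L_def Q_def cr_def by simp
  have L_sub: "x \<in> L k \<Longrightarrow> x \<in> \<Union>(range A) \<and> ord x < k" for x k
    by (induction k) (auto simp: L_0 L_Suc Q_def is_arg_min_def less_Suc_eq)
  have cr_strict: "cr k c + cr k d < cr k x + cr k y"
    if "x \<in> A i" "y \<in> A j" "\<not> R x y" "ord x = k" "c \<in> A i'" "d \<in> A j'"
      "\<forall>w\<in>\<Union>(range A). R w x \<and> R w y \<longrightarrow> R w c \<and> R w d"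
      "\<forall>w\<in>\<Union>(range A). R w x \<or> R w y \<longrightarrow> R w c \<or> R w d" "R x c" "R x d"
    for k x y c d i j i' j'
  proof -
    define W where "W z = {w \<in> \<Union>(range A). ord w = k \<and> \<not> R w z}" for z
    have crW: "cr k z = card (W z)" for z by (simp add: cr_def W_def)
    have finW: "finite (W x)" "finite (W y)" "finite (W c)" "finite (W d)"
      unfolding W_def using fin that by blast+
    \<comment> \<open>An element crossing one of the corners crosses \<open>x\<close> or
      \<open>y\<close>, and one crossing both corners crosses both \<open>x\<close> and
      \<open>y\<close>. Moreover \<open>x\<close> crosses \<open>y\<close> but neither corner, which
      makes the inequality strict.\<close>
    have un: "W c \<union> W d \<subseteq> (W x \<union> W y) - {x}"
      using that(7,9,10) unfolding W_def by blast
    have int: "W c \<inter> W d \<subseteq> W x \<inter> W y"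
      using that(8) unfolding W_def by blast
    have "x \<in> W x \<union> W y" using that(1,3,4) unfolding W_def by blast
    then have "card (W c \<union> W d) < card (W x \<union> W y)"
      using un finW by (intro psubset_card_mono) auto
    moreover have "card (W c \<inter> W d) \<le> card (W x \<inter> W y)"
      using int finW by (intro card_mono) auto
    moreover have "card (W c) + card (W d) = card (W c \<union> W d) + card (W c \<inter> W d)"
      using finW by (intro card_Un_Int)
    moreover have "card (W x) + card (W y) = card (W x \<union> W y) + card (W x \<inter> W y)"
      using finW by (intro card_Un_Int)
    ultimately show ?thesis by (simp add: crW)
  qed
  have L_mono: "L j \<subseteq> L k" if "j \<le> k" for j k
    using that by (rule lift_Suc_mono_le[rotated]) (simp add: L_Suc)
  have L_nested: "\<forall>x\<in>L k. \<forall>y\<in>L k. R x y" for k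
  proof (induction k)
    case 0
    show ?case by (simp add: L_0)
  next
    case (Suc k)
    have new: "R x y" if "is_arg_min (cr k) (Q k i) x" "is_arg_min (cr k) (Q k j) y" for i j x y
    proof (rule ccontr)
      assume xy: "\<not> R x y"
      have x: "x \<in> A i" "ord x = k" "\<forall>w\<in>L k. R w x" and y: "y \<in> A j" "ord y = k" "\<forall>w\<in>L k. R w y"
        and min_x: "\<And>z. Q k i z \<Longrightarrow> cr k x \<le> cr k z" and min_y: "\<And>z. Q k j z \<Longrightarrow> cr k y \<le> cr k z"
        using that by (auto simp: is_arg_min_linorder Q_def)
      obtain c d where cd: "\<forall>w\<in>\<Union>(range A). R w x \<and> R w y \<longrightarrow> R w c \<and> R w d"
          "\<forall>w\<in>\<Union>(range A). R w x \<or> R w y \<longrightarrow> R w c \<or> R w d" "R x c" "R x d"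
        and mem: "c \<in> A i \<and> d \<in> A j \<or> c \<in> A i \<and> d \<in> A i \<and> y \<in> A i \<and> x \<in> A j"
        using uncross[OF x(1) y(1) _ xy] unfolding x(2) y(2) by blast
      have less: "cr k c + cr k d < cr k x + cr k y"
        using mem cr_strict[OF x(1) y(1) xy x(2) _ _ cd] by blast
      have nst: "\<forall>w\<in>L k. R w c \<and> R w d"
      proof
        fix w assume w: "w \<in> L k"
        then have "w \<in> \<Union>(range A)" using L_sub by blast
        with cd(1) have "R w x \<and> R w y \<longrightarrow> R w c \<and> R w d" by (rule bspec)
        then show "R w c \<and> R w d" using x(3) y(3) w by simp
      qed
      show False
        using mem
      proof
        assume "c \<in> A i \<and> d \<in> A j"
        then have "Q k i c" "Q k j d"
          using nst ord_eq[OF _ x(1)] ord_eq[OF _ y(1)] x(2) y(2) by (auto simp: Q_def)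
        then show False using min_x[of c] min_y[of d] less by linarith
      next
        \<comment> \<open>Minimality of \<open>x\<close> against both corners gives
          \<open>2 * cr k x \<le> cr k c + cr k d < cr k x + cr k y\<close>, whereas
          \<open>x\<close> is also a competitor of \<open>y\<close>, so
          \<open>cr k y \<le> cr k x\<close>.\<close>
        assume a: "c \<in> A i \<and> d \<in> A i \<and> y \<in> A i \<and> x \<in> A j"
        then have "Q k i c" "Q k i d" "Q k j x"
          using nst ord_eq[OF _ x(1)] x y by (auto simp: Q_def)
        then show False using min_x[of c] min_x[of d] min_y[of x] less by linarith
      qed
    qed
    have old: "R x y" "R y x" if x: "x \<in> L k" and min_y: "is_arg_min (cr k) (Q k j) y" for x y j
    proof -
      have y: "y \<in> A j" "\<forall>w\<in>L k. R w y"
        using min_y by (auto simp: is_arg_min_def Q_def)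
      then show xy: "R x y" using x by blast
      obtain i where i: "x \<in> A i" using L_sub[OF x] by blast
      show "R y x" using R_sym[OF i y(1) xy] .
    qed
    show ?case
      using Suc new old unfolding L_Suc by blast
  qed
  have L_meets: "L (Suc k) \<inter> A i \<noteq> {}" if nonempty: "A i \<noteq> {}" and k: "\<forall>x\<in>A i. ord x = k" for k i
  proof -
    \<comment> \<open>Crossings with the whole of \<open>L k\<close> can be counted, because only
      the finitely many orders below \<open>k\<close> occur in it.\<close>
    define m where "m x = card {w \<in> L k. \<not> R w x}" for x
    have fin_m: "finite {w \<in> L k. \<not> R w x}" if "x \<in> A i" for x
    proof (rule finite_subset)
      show "{w \<in> L k. \<not> R w x} \<subseteq> (\<Union>l<k. {w \<in> \<Union>(range A). ord w = l \<and> \<not> R w x})"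
        using L_sub[where k = k] by fastforce
      show "finite (\<Union>l<k. {w \<in> \<Union>(range A). ord w = l \<and> \<not> R w x})"
        by (rule finite_UN_I[OF finite_lessThan fin[OF that]])
    qed
    obtain x0 where "x0 \<in> A i" using nonempty by blast
    from ex_has_least_nat[of "\<lambda>x. x \<in> A i", OF this, of m]
    obtain x where x: "x \<in> A i" "\<And>z. z \<in> A i \<Longrightarrow> m x \<le> m z" by auto
    have "\<forall>w\<in>L k. R w x"
    proof (rule ccontr)
      assume "\<not> ?thesis"
      then obtain y where y: "y \<in> L k" "\<not> R y x" by blast
      obtain j where j: "y \<in> A j" using L_sub[OF y(1)] by blast
      have xy: "\<not> R x y" using R_sym[OF x(1) j] y(2) by blast
      \<comment> \<open>Strict inequality rules out the outcome that requires equal orders, so one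
        corner remains a candidate for \<open>i\<close>.\<close>
      have less: "ord y < ord x" using L_sub[OF y(1)] k x(1) by auto
      obtain c where c: "c \<in> A i" "\<forall>w\<in>\<Union>(range A). R w x \<and> R w y \<longrightarrow> R w c" "R y c"
        using uncross[OF x(1) j less_imp_le[OF less] xy] less by auto
      \<comment> \<open>The elements of \<open>L k\<close> are all nested with \<open>y\<close>;
        hence those nested with \<open>x\<close> stay nested with \<open>c\<close>, and
        \<open>y\<close> itself is gained.\<close>
      have "{w \<in> L k. \<not> R w c} \<subset> {w \<in> L k. \<not> R w x}"
      proof (rule psubsetI)
        show "{w \<in> L k. \<not> R w c} \<subseteq> {w \<in> L k. \<not> R w x}"
        proof
          fix w assume w: "w \<in> {w \<in> L k. \<not> R w c}"
          then have "w \<in> \<Union>(range A)" "R w y"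
            using L_sub L_nested[of k] y(1) by auto
          then have "\<not> R w x" using bspec[OF c(2), of w] w by blast
          then show "w \<in> {w \<in> L k. \<not> R w x}" using w by blast
        qed
        show "{w \<in> L k. \<not> R w c} \<noteq> {w \<in> L k. \<not> R w x}"
          using y c(3) by blast
      qed
      then have "m c < m x"
        unfolding m_def using fin_m[OF x(1)] by (rule psubset_card_mono[rotated])
      then show False using x(2)[OF c(1)] by simp
    qed
    then have "Q k i x" using x k by (simp add: Q_def)
    from ex_has_least_nat[of "Q k i", OF this, of "cr k"]
    obtain z where "is_arg_min (cr k) (Q k i) z"
      by (auto simp: is_arg_min_linorder)
    then show ?thesis
      unfolding L_Suc by (auto simp: is_arg_min_def Q_def)
  qed
  have meets: "(\<Union>k. L k) \<inter> A i \<noteq> {}" if nonempty: "A i \<noteq> {}" for i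
  proof -
    obtain x where "x \<in> A i" using nonempty by blast
    then have "\<forall>y\<in>A i. ord y = ord x" using ord_eq by blast
    from L_meets[OF nonempty this] show ?thesis by blast
  qed
  have nested: "R x y" if x: "x \<in> L k" and y: "y \<in> L l" for x y k l
  proof -
    have "x \<in> L (max k l)" "y \<in> L (max k l)"
      using L_mono[of k "max k l"] L_mono[of l "max k l"] x y by auto
    then show ?thesis using L_nested by blast
  qed
  show ?thesis
  proof (intro exI conjI allI ballI impI)
    show "(\<Union>k. L k) \<subseteq> \<Union>(range A)"
      using L_sub by (intro UN_least subsetI) fastforce
    show "(\<Union>k. L k) \<inter> A i \<noteq> {}" if "A i \<noteq> {}" for i using that by (rule meets)
    show "R x y" if "x \<in> (\<Union>k. L k)" "y \<in> (\<Union>k. L k)" for x y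
      using that nested by (elim UN_E)
  qed
qed

section \<open>Corners\<close>

text \<open>For sides \<open>a\<close> of \<open>X\<close> and \<open>d\<close> of \<open>Y\<close>,
  this is the separator belonging to the side \<open>a \<inter> d\<close>.\<close>

definition corner :: "'a set \<Rightarrow> 'a set \<Rightarrow> 'a set \<Rightarrow> 'a set \<Rightarrow> 'a set" where
  "corner X Y a d = X \<inter> Y \<union> X \<inter> d \<union> Y \<inter> a"

lemma corner_commute: "corner X Y a d = corner Y X d a"
  by (auto simp: corner_def)

lemma full_comp_disjoint:
  assumes "C \<in> full_comps V E X" "K \<in> comps V E X" "C \<noteq> K"
  shows "C \<inter> K = {}"
  using comps_eqI[OF full_comps_comps[OF assms(1)] assms(2)] assms(3) by blast

text \<open>Here it matters that \<open>C\<close> is a single component: the corner either stays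
  within \<open>X \<union> C\<close> or leaves \<open>C\<close> untouched, so that \<open>C\<close>
  ties \<open>X\<close> together outside the corner.\<close>

lemma nest_corner:
  assumes "C \<in> full_comps V E X" "tight V E (corner X Y a d)"
    and "a = C \<or> a = V - X - C"
  shows "nest V E X (corner X Y a d)"
  using assms(3)
proof
  assume "a = C"
  then have "corner X Y a d \<subseteq> X \<union> C" by (auto simp: corner_def)
  then show ?thesis
    using full_comps_comps[OF assms(1)] by (auto simp: nest_def)
next
  assume a: "a = V - X - C"
  have "C \<subseteq> V - X" using assms(1) by (simp add: full_comps_iff)
  then have "C \<inter> corner X Y a d = {}" using a by (auto simp: corner_def)
  then show ?thesis
    using nest_sym[OF assms(2)] nest_if_full_comp_avoids[OF assms(1)] by blast
qed

text \<open>If \<open>W\<close> lies in \<open>X \<union> C\<close>, then \<open>C\<close> joins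
  \<open>W\<close> to one component of \<open>G - c'\<close>. Otherwise \<open>W\<close> avoids
  \<open>C\<close>, and \<open>C\<close> joins \<open>c\<close> to one component of
  \<open>G - W\<close>.\<close>

lemma nest_either_side:
  assumes C: "C \<in> full_comps V E X" and "tight V E c'" "c \<subseteq> X \<union> C" "C \<inter> c' = {}" "nest V E X W"
  shows "nest V E W c \<or> nest V E W c'"
proof -
  obtain K where K: "K \<in> comps V E X" "W \<subseteq> X \<union> K" using assms(5) by (auto simp: nest_def)
  show ?thesis
  proof (cases "C = K")
    case True
    obtain L where L: "L \<in> comps V E c'" "C \<union> (X - c') \<subseteq> L"
      using full_comp_avoiding[OF C assms(4)] by blast
    then have "W \<subseteq> c' \<union> L" using K True by blast
    with L have "nest V E c' W" unfolding nest_def by blast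
    then show ?thesis using nest_sym[OF assms(2)] by blast
  next
    case False
    have "C \<inter> W = {}"
      using full_comp_disjoint[OF C K(1) False] K C by (auto simp: full_comps_iff)
    from full_comp_avoiding[OF C this] obtain L where L: "L \<in> comps V E W" "C \<union> (X - W) \<subseteq> L" ..
    then have "c \<subseteq> W \<union> L" using assms(3) by blast
    with L show ?thesis unfolding nest_def by blast
  qed
qed

text \<open>Opposite corners lie on different sides of \<open>X\<close>: one within
  \<open>X \<union> C\<close>, the other disjoint from \<open>C\<close>. The sides \<open>d\<close>
  and \<open>d'\<close> of \<open>Y\<close> do not affect this.\<close>

lemma nest_either_corner:
  assumes "C \<in> full_comps V E X" "a = C \<or> a = V - X - C"
    and "tight V E (corner X Y a d)" "tight V E (corner X Y (V - X - a) d')" "nest V E X W"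
  shows "nest V E W (corner X Y a d) \<or> nest V E W (corner X Y (V - X - a) d')"
proof -
  have CV: "C \<subseteq> V - X" using assms(1) by (simp add: full_comps_iff)
  from assms(2) show ?thesis
  proof
    assume a: "a = C"
    show ?thesis
      by (rule nest_either_side[OF assms(1,4) _ _ assms(5)]) (use a CV in \<open>auto simp: corner_def\<close>)
  next
    assume a: "a = V - X - C"
    then have a': "V - X - a = C" using CV by blast
    have "nest V E W (corner X Y (V - X - a) d') \<or> nest V E W (corner X Y a d)"
      unfolding a'
      by (rule nest_either_side[OF assms(1,3) _ _ assms(5)]) (use a CV in \<open>auto simp: corner_def\<close>)
    then show ?thesis by blast
  qed
qed

lemma crossing_corners:
  assumes "tight V E X" "tight V E Y" "\<not> nest V E X Y"
    and C: "C \<in> full_comps V E X" "a = C \<or> a = V - X - C"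
    and D: "D \<in> full_comps V E Y" "d = D \<or> d = V - Y - D"
    and c: "c = corner X Y a d" "tight V E c"
    and c': "c' = corner X Y (V - X - a) (V - Y - d)" "tight V E c'"
  shows "\<lbrakk>tight V E W; nest V E W X; nest V E W Y\<rbrakk> \<Longrightarrow> nest V E W c \<and> nest V E W c'"
    and "\<lbrakk>tight V E W; nest V E W X \<or> nest V E W Y\<rbrakk> \<Longrightarrow> nest V E W c \<or> nest V E W c'"
    and "nest V E X c \<and> nest V E X c' \<and> nest V E Y c \<and> nest V E Y c'"
proof -
  have CV: "C \<subseteq> V - X" "D \<subseteq> V - Y" using C D by (simp_all add: full_comps_iff)
  have C': "V - X - a = C \<or> V - X - a = V - X - C" using C(2) CV by blast
  have D': "V - Y - d = D \<or> V - Y - d = V - Y - D" using D(2) CV by blast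
  have cY: "c = corner Y X d a" "c' = corner Y X (V - Y - d) (V - X - a)"
    using c c' corner_commute by metis+
  show "nest V E W c \<and> nest V E W c'" if W: "tight V E W" "nest V E W X" "nest V E W Y"
  proof -
    have "\<not> nest V E Y X" using assms(2,3) nest_sym by metis
    from nest_crossing_Un[OF assms(1) W(1) this W(2,3)]
    obtain H where "H \<in> comps V E W" "X \<union> Y \<subseteq> W \<union> H" ..
    moreover have "c \<subseteq> X \<union> Y" "c' \<subseteq> X \<union> Y" by (auto simp: c c' corner_def)
    ultimately show ?thesis unfolding nest_def by blast
  qed
  show "nest V E W c \<or> nest V E W c'" if W: "tight V E W" "nest V E W X \<or> nest V E W Y"
    using W(2)
  proof
    assume "nest V E W X"
    then have "nest V E X W" using W(1) by (rule nest_sym[rotated])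
    then show ?thesis
      unfolding c(1) c'(1) using c c' by (intro nest_either_corner[OF C]) simp_all
  next
    assume "nest V E W Y"
    then have "nest V E Y W" using W(1) by (rule nest_sym[rotated])
    then show ?thesis
      using c(2) c'(2) unfolding cY by (intro nest_either_corner[OF D])
  qed
  show "nest V E X c \<and> nest V E X c' \<and> nest V E Y c \<and> nest V E Y c'"
  proof (intro conjI)
    show "nest V E X c" using c(2) unfolding c(1) by (rule nest_corner[OF C(1) _ C(2)])
    show "nest V E X c'" using c'(2) unfolding c'(1) by (rule nest_corner[OF C(1) _ C'])
    show "nest V E Y c" using c(2) unfolding cY by (rule nest_corner[OF D(1) _ D(2)])
    show "nest V E Y c'" using c'(2) unfolding cY by (rule nest_corner[OF D(1) _ D'])
  qed
qed

section \<open>From nested separators to nested separations\<close>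

text \<open>
  For nested \<open>X \<noteq> Y\<close> of which neither contains the other, the separations \<open>{X, \<C>}\<close> and \<open>{Y, \<D>}\<close> with
  \<open>\<C>\<close> and \<open>\<D>\<close> consisting of full components can cross only if \<open>\<C>\<close> contains the component meeting \<open>Y\<close>
  and \<open>\<D>\<close> the one meeting \<open>X\<close>. This is excluded if \<open>\<C>\<close> and \<open>\<D>\<close> avoid the roots \<open>\<rho> X\<close> and \<open>\<rho> Y\<close>: then
  each root lies in a full component of the other separator, so both contain the same first vertex,
  although they are disjoint.
\<close>

definition root_choice :: "'a set \<Rightarrow> 'a set set \<Rightarrow> ('a set \<Rightarrow> 'a set) \<Rightarrow> bool" where
  "root_choice V E \<rho> \<longleftrightarrow>
     (\<forall>X. full_comps V E X \<noteq> {} \<longrightarrow> \<rho> X \<in> full_comps V E X) \<and>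
     (\<forall>X Y. full_comps V E X \<noteq> {} \<longrightarrow> full_comps V E Y \<noteq> {} \<longrightarrow>
        \<rho> X \<subseteq> \<Union>(full_comps V E Y) \<longrightarrow> \<rho> Y \<subseteq> \<Union>(full_comps V E X) \<longrightarrow> \<rho> X \<inter> \<rho> Y \<noteq> {})"

lemma root_choice_exists:
  fixes V :: "'a set"
  shows "\<exists>\<rho>. root_choice V E \<rho>"
proof -
  obtain r :: "'a rel" where r: "well_order_on UNIV r"
    using well_order_on by blast
  then have antisym: "antisym r" and total: "total_on UNIV r" and wf: "wf (r - Id)" and refl: "refl_on UNIV r"
    by (auto simp: well_order_on_def linear_order_on_def partial_order_on_def preorder_on_def)
  have least: "\<exists>z. z \<in> Q \<and> (\<forall>y\<in>Q. (z, y) \<in> r)" if "Q \<noteq> {}" for Q :: "'a set"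
  proof -
    from wfE_min'[OF wf that] obtain z where z: "z \<in> Q" "\<And>y. (y, z) \<in> r - Id \<Longrightarrow> y \<notin> Q" by blast
    have "(z, y) \<in> r" if "y \<in> Q" for y
    proof (cases "y = z")
      case True
      then show ?thesis using refl by (simp add: refl_on_def)
    next
      case False
      then have "(y, z) \<notin> r" using z(2)[of y] that by blast
      then show ?thesis using total False by (auto simp: total_on_def)
    qed
    with z(1) show ?thesis by blast
  qed
  have "\<exists>v C. full_comps V E X \<noteq> {} \<longrightarrow> C \<in> full_comps V E X \<and> v \<in> C \<and>
      (\<forall>u\<in>\<Union>(full_comps V E X). (v, u) \<in> r)" for X
  proof (cases "full_comps V E X = {}")
    case False
    then obtain C where C: "C \<in> full_comps V E X" by blast
    then have "C \<noteq> {}" by (simp add: full_comps_iff)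
    with C have "\<Union>(full_comps V E X) \<noteq> {}" by blast
    from least[OF this] show ?thesis by blast
  qed simp
  then obtain v \<rho> where v: "\<And>X. full_comps V E X \<noteq> {} \<Longrightarrow> \<rho> X \<in> full_comps V E X \<and> v X \<in> \<rho> X \<and>
      (\<forall>u\<in>\<Union>(full_comps V E X). (v X, u) \<in> r)"
    by metis
  have "root_choice V E \<rho>"
    unfolding root_choice_def
  proof (intro conjI allI impI)
    fix X Y
    assume ne: "full_comps V E X \<noteq> {}" "full_comps V E Y \<noteq> {}"
      and sub: "\<rho> X \<subseteq> \<Union>(full_comps V E Y)" "\<rho> Y \<subseteq> \<Union>(full_comps V E X)"
    \<comment> \<open>Each first vertex lies in the union over which the other one is
      minimal.\<close>
    have "(v Y, v X) \<in> r" "(v X, v Y) \<in> r"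
      using v[OF ne(1)] v[OF ne(2)] sub by blast+
    then have "v X = v Y" using antisym by (auto simp: antisym_def)
    then show "\<rho> X \<inter> \<rho> Y \<noteq> {}" using v[OF ne(1)] v[OF ne(2)] by auto
  qed (use v in blast)
  then show ?thesis by (rule exI[of _ \<rho>])
qed

text \<open>Singletons serve when the distinguishing component is not the root, the large arm when
  it is the root. Two arms at the same \<open>X\<close> are disjoint or contained in each
  other.\<close>

definition arms :: "'a set \<Rightarrow> 'a set set \<Rightarrow> ('a set \<Rightarrow> 'a set) \<Rightarrow> 'a set \<Rightarrow> 'a set set set" where
  "arms V E \<rho> X = insert (full_comps V E X - {\<rho> X}) ((\<lambda>C. {C}) ` (full_comps V E X - {\<rho> X}))"

text \<open>Three of the four ways in which \<open>{V - S, X \<union> S}\<close> and \<open>{V - S', Y \<union> S'}\<close> can be nested.\<close>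

definition nested_sides :: "'a set \<Rightarrow> 'a set \<Rightarrow> 'a set \<Rightarrow> 'a set \<Rightarrow> bool" where
  "nested_sides X S Y S' \<longleftrightarrow>
     S \<inter> S' = {} \<and> X \<inter> S' = {} \<and> Y \<inter> S = {} \<or>
     S \<subseteq> S' \<and> X \<subseteq> Y \<union> S' \<or>
     S' \<subseteq> S \<and> Y \<subseteq> X \<union> S"

lemma nested_sides_sym: "nested_sides X S Y S' \<Longrightarrow> nested_sides Y S' X S"
  by (auto simp: nested_sides_def)

lemma full_comp_in_given:
  assumes "C \<in> full_comps V E X" "C \<inter> Y = {}" "L \<in> comps V E Y" "X \<subseteq> Y \<union> L" "X - Y \<noteq> {}"
  shows "C \<subseteq> L"
proof -
  obtain L' where L': "L' \<in> comps V E Y" "C \<union> (X - Y) \<subseteq> L'"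
    using full_comp_avoiding[OF assms(1,2)] by blast
  have "L' = L"
    by (rule comps_eqI[OF L'(1) assms(3)]) (use L' assms in blast)
  with L' show ?thesis by blast
qed

lemma separator_disjoint_Union:
  assumes "\<C> \<subseteq> full_comps V E X"
  shows "X \<inter> \<Union>\<C> = {}"
proof -
  have "C \<subseteq> V - X" if "C \<in> \<C>" for C
    using subsetD[OF assms that] by (simp add: full_comps_iff)
  then show ?thesis by blast
qed

text \<open>Everything in \<open>\<C>\<close> hangs on \<open>X - Y\<close> without meeting
  \<open>Y\<close>, hence lies in the one component \<open>L\<close> of \<open>G - Y\<close> that
  holds the rest of \<open>X\<close>. Whether \<open>L\<close> belongs to \<open>\<D>\<close>
  decides between inclusion and disjointness.\<close>

lemma nested_sides_avoiding:
  assumes "nest V E Y X" "\<C> \<subseteq> full_comps V E X" "\<D> \<subseteq> full_comps V E Y"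
    and "Y \<inter> \<Union>\<C> = {}" "X - Y \<noteq> {}"
  shows "nested_sides X (\<Union>\<C>) Y (\<Union>\<D>)"
proof -
  obtain L where L: "L \<in> comps V E Y" "X \<subseteq> Y \<union> L" using assms(1) by (auto simp: nest_def)
  have sub: "\<Union>\<C> \<subseteq> L"
  proof
    fix v assume "v \<in> \<Union>\<C>"
    then obtain C where C: "v \<in> C" "C \<in> \<C>" by blast
    have "C \<subseteq> L"
      by (rule full_comp_in_given[OF _ _ L assms(5)]) (use C assms in blast)+
    with C show "v \<in> L" by blast
  qed
  show ?thesis
  proof (cases "L \<in> \<D>")
    case True
    then have "\<Union>\<C> \<subseteq> \<Union>\<D>" "X \<subseteq> Y \<union> \<Union>\<D>" using sub L by blast+
    then show ?thesis by (simp add: nested_sides_def)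
  next
    case False
    have "L \<inter> \<Union>\<D> = {}" using full_comp_disjoint[OF _ L(1)] False assms(3) by blast
    moreover have "Y \<inter> \<Union>\<D> = {}" using separator_disjoint_Union[OF assms(3)] .
    ultimately have "\<Union>\<C> \<inter> \<Union>\<D> = {}" "X \<inter> \<Union>\<D> = {}" using sub L by blast+
    then show ?thesis using assms(4) by (simp add: nested_sides_def)
  qed
qed

lemma arms_sub: "\<C> \<in> arms V E \<rho> X \<Longrightarrow> \<C> \<subseteq> full_comps V E X - {\<rho> X}"
  by (auto simp: arms_def)

lemma tight_full_comps: "tight V E X \<Longrightarrow> full_comps V E X \<noteq> {}"
  by (auto simp: tight_def)

text \<open>Since \<open>Y\<close> meets \<open>\<Union>\<C>\<close>, the component holding the rest
  of \<open>Y\<close> belongs to the arm and is not the root. The root therefore avoids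
  \<open>Y\<close> and follows \<open>X - Y\<close> into a component that belongs to
  \<open>\<D>\<close>.\<close>

lemma arms_root_sub:
  assumes C: "\<C> \<in> arms V E \<rho> X" and R: "\<rho> X \<in> full_comps V E X"
    and "nest V E X Y" "nest V E Y X" "Y \<inter> \<Union>\<C> \<noteq> {}" "X - Y \<noteq> {}" "X \<inter> \<Union>\<D> \<noteq> {}"
    and D: "\<D> \<subseteq> full_comps V E Y"
  shows "\<exists>L\<in>\<D>. \<rho> X \<subseteq> L"
proof -
  obtain L where L: "L \<in> comps V E Y" "X \<subseteq> Y \<union> L" using assms(4) by (auto simp: nest_def)
  obtain K where K: "K \<in> comps V E X" "Y \<subseteq> X \<union> K" using assms(3) by (auto simp: nest_def)
  have Csub: "\<C> \<subseteq> full_comps V E X - {\<rho> X}" using arms_sub[OF C] .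
  obtain y C where y: "y \<in> Y" "y \<in> C" "C \<in> \<C>" using assms(5) by blast
  have Cf: "C \<in> full_comps V E X" "C \<noteq> \<rho> X" using Csub y by blast+
  have "y \<in> K" using y K Cf(1) by (auto simp: full_comps_iff)
  then have "C = K" using full_comp_disjoint[OF Cf(1) K(1)] y by blast
  then have "\<rho> X \<inter> K = {}" using full_comp_disjoint[OF R K(1)] Cf by blast
  then have "\<rho> X \<inter> Y = {}" using K R by (auto simp: full_comps_iff)
  then have sub: "\<rho> X \<subseteq> L" by (rule full_comp_in_given[OF R _ L assms(6)])
  obtain x D where x: "x \<in> X" "x \<in> D" "D \<in> \<D>" using assms(7) by blast
  have Df: "D \<in> full_comps V E Y" using D x by blast
  have "x \<in> L" using x L Df by (auto simp: full_comps_iff)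
  then have "D = L" using full_comp_disjoint[OF Df L(1)] x by blast
  with sub x show ?thesis by blast
qed

lemma arms_nested:
  assumes \<rho>: "root_choice V E \<rho>"
    and X: "tight V E X" and Y: "tight V E Y" and XY: "nest V E X Y"
    and C: "\<C> \<in> arms V E \<rho> X" and D: "\<D> \<in> arms V E \<rho> Y"
  shows "nested_sides X (\<Union>\<C>) Y (\<Union>\<D>)"
proof -
  have YX: "nest V E Y X" using nest_sym[OF X XY] .
  have Cs: "\<C> \<subseteq> full_comps V E X" and Ds: "\<D> \<subseteq> full_comps V E Y"
    using arms_sub[OF C] arms_sub[OF D] by blast+
  have RX: "\<rho> X \<in> full_comps V E X" and RY: "\<rho> Y \<in> full_comps V E Y"
    using \<rho> tight_full_comps[OF X] tight_full_comps[OF Y] by (auto simp: root_choice_def)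
  consider "X = Y" | "Y \<inter> \<Union>\<C> = {}" "X - Y \<noteq> {}" | "X \<inter> \<Union>\<D> = {}" "Y - X \<noteq> {}"
    | "Y \<inter> \<Union>\<C> \<noteq> {}" "X - Y \<noteq> {}" "X \<inter> \<Union>\<D> \<noteq> {}" "Y - X \<noteq> {}"
  proof (cases "X \<subseteq> Y \<or> Y \<subseteq> X")
    case True
    then consider "X = Y" | "X \<subseteq> Y" "Y - X \<noteq> {}" | "Y \<subseteq> X" "X - Y \<noteq> {}" by blast
    then show thesis
      using that(1-3) separator_disjoint_Union[OF Cs] separator_disjoint_Union[OF Ds]
      by cases blast+
  next
    case False
    then have "X - Y \<noteq> {}" "Y - X \<noteq> {}" by blast+
    with that(2-4) show thesis by blast
  qed
  then show ?thesis
  proof cases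
    case 1
    have disj: "X \<inter> \<Union>\<C> = {}" "X \<inter> \<Union>\<D> = {}"
      using separator_disjoint_Union[OF Cs] separator_disjoint_Union[OF Ds] 1 by simp_all
    have "\<C> \<inter> \<D> = {} \<or> \<C> \<subseteq> \<D> \<or> \<D> \<subseteq> \<C>"
      using C D 1 by (auto simp: arms_def)
    then consider "\<C> \<inter> \<D> = {}" | "\<C> \<subseteq> \<D>" | "\<D> \<subseteq> \<C>" by blast
    then show ?thesis
    proof cases
      assume a: "\<C> \<inter> \<D> = {}"
      have "C \<inter> D = {}" if "C \<in> \<C>" "D \<in> \<D>" for C D
        by (rule full_comp_disjoint[OF _ full_comps_comps]) (use that Cs Ds 1 a in blast)+
      then have "\<Union>\<C> \<inter> \<Union>\<D> = {}" by blast
      then show ?thesis using disj 1 by (simp add: nested_sides_def)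
    qed (use 1 in \<open>auto simp: nested_sides_def\<close>)
  next
    case 2
    then show ?thesis by (rule nested_sides_avoiding[OF YX Cs Ds])
  next
    case 3
    then show ?thesis by (intro nested_sides_sym[OF nested_sides_avoiding[OF XY Ds Cs]])
  next
    case 4
    \<comment> \<open>This case is contradictory: the choice of roots makes \<open>\<rho> X\<close>
      and \<open>\<rho> Y\<close> meet, but \<open>\<rho> X\<close> lies in a member of
      \<open>\<D>\<close>, from which \<open>\<rho> Y\<close> is disjoint.\<close>
    obtain L where L: "L \<in> \<D>" "\<rho> X \<subseteq> L" using arms_root_sub[OF C RX XY YX 4(1,2,3) Ds] ..
    obtain K where K: "K \<in> \<C>" "\<rho> Y \<subseteq> K" using arms_root_sub[OF D RY YX XY 4(3,4,1) Cs] ..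
    have "\<rho> X \<inter> \<rho> Y \<noteq> {}"
      using \<rho> tight_full_comps[OF X] tight_full_comps[OF Y] L K Cs Ds
      unfolding root_choice_def by (metis Sup_upper subset_iff)
    moreover have "\<rho> Y \<inter> L = {}"
      by (rule full_comp_disjoint[OF RY]) (use L Ds arms_sub[OF D] in \<open>auto dest: full_comps_comps\<close>)
    ultimately show ?thesis using L by blast
  qed
qed

section \<open>Tangles as ultrafilters\<close>

definition fin_osep :: "'a set \<Rightarrow> 'a set set \<Rightarrow> 'a set \<Rightarrow> 'a set \<Rightarrow> bool" where
  "fin_osep V E A B \<longleftrightarrow>
     A \<union> B = V \<and> (\<forall>u\<in>A - B. \<forall>v\<in>B - A. {u, v} \<notin> E) \<and> finite (A \<inter> B)"

lemma fin_osep_commute: "fin_osep V E A B \<longleftrightarrow> fin_osep V E B A"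
proof -
  have "(\<forall>u\<in>A - B. \<forall>v\<in>B - A. {u, v} \<notin> E) \<longleftrightarrow> (\<forall>u\<in>B - A. \<forall>v\<in>A - B. {u, v} \<notin> E)"
    by (metis insert_commute)
  then show ?thesis by (simp add: fin_osep_def Un_commute Int_commute)
qed

lemma fin_separations_iff: "{A, B} \<in> fin_separations V E \<longleftrightarrow> fin_osep V E A B"
proof
  assume "{A, B} \<in> fin_separations V E"
  then obtain A' B' where AB: "{A, B} = {A', B'}" "A' \<union> B' = V" "finite (A \<inter> B)"
    "\<forall>u\<in>A' - B'. \<forall>v\<in>B' - A'. {u, v} \<notin> E"
    by (auto simp: fin_separations_def separations_def)
  then have "A = A' \<and> B = B' \<or> A = B' \<and> B = A'" by (simp add: doubleton_eq_iff)
  then show "fin_osep V E A B"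
  proof
    assume "A = A' \<and> B = B'"
    then show ?thesis using AB by (simp add: fin_osep_def)
  next
    assume "A = B' \<and> B = A'"
    then have "fin_osep V E B A" using AB by (simp add: fin_osep_def Int_commute)
    then show ?thesis by (simp add: fin_osep_commute)
  qed
next
  assume "fin_osep V E A B"
  then show "{A, B} \<in> fin_separations V E"
    by (auto simp: fin_separations_def separations_def fin_osep_def)
qed

lemma tangle_fin_osep:
  assumes "aleph0_tangle V E \<tau>" "(A, B) \<in> \<tau>"
  shows "fin_osep V E A B"
proof -
  have "\<tau> \<subseteq> orientations (fin_separations V E)"
    using assms(1) by (simp add: aleph0_tangle_def orientation_of_def)
  then have "underlying (A, B) \<in> fin_separations V E"
    using assms(2) unfolding orientations_def by blast
  then show ?thesis by (simp add: fin_separations_iff)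
qed

lemma tangle_total:
  assumes "aleph0_tangle V E \<tau>" "fin_osep V E A B"
  shows "(A, B) \<in> \<tau> \<or> (B, A) \<in> \<tau>"
proof -
  have "\<exists>!p. p \<in> \<tau> \<and> underlying p = {A, B}"
    using assms by (simp add: aleph0_tangle_def orientation_of_def fin_separations_iff)
  then obtain p where p: "p \<in> \<tau>" "underlying p = {A, B}" by blast
  then show ?thesis
    by (cases p) (auto simp: doubleton_eq_iff)
qed

lemma tangle_star:
  assumes "aleph0_tangle V E \<tau>" "\<sigma> \<subseteq> \<tau>" "finite \<sigma>" "osep_star \<sigma>"
  shows "infinite (star_interior V \<sigma>)"
  using assms unfolding aleph0_tangle_def by blast

lemma tangle_infinite:
  assumes "aleph0_tangle V E \<tau>" "(A, B) \<in> \<tau>"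
  shows "infinite B"
proof
  assume "finite B"
  then have "finite (star_interior V {(A, B)})" by (simp add: star_interior_def)
  moreover have "infinite (star_interior V {(A, B)})"
    using assms by (intro tangle_star[OF assms(1)]) (auto simp: osep_star_def)
  ultimately show False by contradiction
qed

text \<open>Uniqueness of the orientation only yields \<open>A = B\<close>, since a degenerate
  separation is its own inverse. It is excluded because its side would coincide with its finite
  separator.\<close>

lemma tangle_antisym:
  assumes "aleph0_tangle V E \<tau>" "(A, B) \<in> \<tau>" "(B, A) \<in> \<tau>"
  shows False
proof -
  have fin: "fin_osep V E A B" using tangle_fin_osep[OF assms(1,2)] .
  then have "\<exists>!p. p \<in> \<tau> \<and> underlying p = {A, B}"
    using assms(1) by (simp add: aleph0_tangle_def orientation_of_def fin_separations_iff)
  moreover have "underlying (A, B) = {A, B}" "underlying (B, A) = {A, B}" by auto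
  ultimately have "(A, B) = (B, A)" using assms(2,3) by blast
  then have "A = B" by (rule Pair_inject)
  then have "finite B" using fin by (auto simp: fin_osep_def)
  then show False using tangle_infinite[OF assms(1,2)] by contradiction
qed

lemma tangle_mono:
  assumes "aleph0_tangle V E \<tau>" "(A, B) \<in> \<tau>" "C \<subseteq> A" "B \<subseteq> D" "fin_osep V E C D"
  shows "(C, D) \<in> \<tau>"
proof (rule ccontr)
  assume neg: "(C, D) \<notin> \<tau>"
  then have DC: "(D, C) \<in> \<tau>" using tangle_total[OF assms(1,5)] by blast
  have fin: "fin_osep V E A B" using tangle_fin_osep[OF assms(1,2)] .
  show False
  \<comment> \<open>Consistency speaks only of distinct separations. For the same separation, the
    inequality between its two orientations would make one side equal to the finite
    separator.\<close>
  proof (cases "{C, D} = {A, B}")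
    case True
    with neg assms(2) have "C = B" "D = A" by (auto simp: doubleton_eq_iff)
    then have "B = A \<inter> B" using assms(3) by blast
    then have "finite B" using fin by (simp add: fin_osep_def)
    then show False using tangle_infinite[OF assms(1,2)] by contradiction
  next
    case False
    then have "underlying (C, D) \<noteq> underlying (A, B)" "osep_less (C, D) (A, B)"
      using assms(3,4) by (auto simp: osep_less_def)
    moreover have "underlying (C, D) \<in> fin_separations V E" "underlying (A, B) \<in> fin_separations V E"
      using fin assms(5) by (simp_all add: fin_separations_iff)
    moreover have "prod.swap (C, D) \<in> \<tau>" using DC by simp
    ultimately have "\<not> consistent (fin_separations V E) \<tau>"
      using assms(2) unfolding consistent_def by blast
    then show False using assms(1) by (simp add: aleph0_tangle_def)
  qed
qed

lemma fin_osep_Int: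
  assumes "fin_osep V E A B" "fin_osep V E C D"
  shows "fin_osep V E (A \<union> C) (B \<inter> D)"
  unfolding fin_osep_def
proof (intro conjI ballI)
  show "A \<union> C \<union> B \<inter> D = V" using assms by (auto simp: fin_osep_def)
  have "(A \<union> C) \<inter> (B \<inter> D) \<subseteq> A \<inter> B \<union> C \<inter> D" by blast
  then show "finite ((A \<union> C) \<inter> (B \<inter> D))"
    using assms by (auto simp: fin_osep_def intro: finite_subset)
  fix u v assume uv: "u \<in> A \<union> C - B \<inter> D" "v \<in> B \<inter> D - (A \<union> C)"
  moreover have "u \<in> A - B \<or> u \<in> C - D"
    using uv(1) assms by (auto simp: fin_osep_def)
  ultimately show "{u, v} \<notin> E" using assms by (auto simp: fin_osep_def)
qed

text \<open>If \<open>\<tau>\<close> contained \<open>(B \<inter> D, A \<union> C)\<close>, it would contain a three-element star with finite interior.\<close>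

lemma tangle_Int:
  assumes tg: "aleph0_tangle V E \<tau>" and AB: "(A, B) \<in> \<tau>" and CD: "(C, D) \<in> \<tau>"
  shows "(A \<union> C, B \<inter> D) \<in> \<tau>"
proof (rule ccontr)
  assume neg: "(A \<union> C, B \<inter> D) \<notin> \<tau>"
  have fin: "fin_osep V E A B" "fin_osep V E C D"
    using tangle_fin_osep[OF tg] AB CD by blast+
  have p3: "(B \<inter> D, A \<union> C) \<in> \<tau>"
    using tangle_total[OF tg fin_osep_Int[OF fin]] neg by blast
  have "fin_osep V E (A \<union> D) (B \<inter> C)"
    using fin fin_osep_Int[of V E A B D C] by (simp add: fin_osep_commute)
  then have p2: "(B \<inter> C, A \<union> D) \<in> \<tau>"
    by (intro tangle_mono[OF tg CD]) (auto simp: fin_osep_commute)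
  let ?\<sigma> = "{(A, B), (B \<inter> C, A \<union> D), (B \<inter> D, A \<union> C)}"
  have "osep_star ?\<sigma>" unfolding osep_star_def by auto
  then have "infinite (star_interior V ?\<sigma>)"
    using AB p2 p3 by (intro tangle_star[OF tg]) auto
  moreover have "star_interior V ?\<sigma> \<subseteq> A \<inter> B \<union> C \<inter> D"
    by (auto simp: star_interior_def)
  then have "finite (star_interior V ?\<sigma>)"
    by (rule finite_subset) (use fin in \<open>simp add: fin_osep_def\<close>)
  ultimately show False by contradiction
qed

text \<open>Records the orientation without mentioning a separator, by taking the smallest possible
  one. Sets with infinite neighbourhood are not big by convention, so failure to be big can be read
  as bigness of the complement only when the neighbourhood is finite.\<close>

definition big :: "'a set \<Rightarrow> 'a set set \<Rightarrow> 'a osep set \<Rightarrow> 'a set \<Rightarrow> bool" where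
  "big V E \<tau> S \<longleftrightarrow> S \<subseteq> V \<and> finite (nbhd V E S) \<and> (V - S, S \<union> nbhd V E S) \<in> \<tau>"

lemma nbhd_sub: "nbhd V E S \<subseteq> V"
  by (auto simp: nbhd_def)

lemma nbhd_Int: "nbhd V E (S \<inter> S') \<subseteq> nbhd V E S \<union> nbhd V E S'"
  by (auto simp: nbhd_def)

lemma nbhd_Union: "(\<And>S. S \<in> \<S> \<Longrightarrow> nbhd V E S \<subseteq> X) \<Longrightarrow> nbhd V E (\<Union>\<S>) \<subseteq> X"
  by (auto simp: nbhd_def)

lemma nbhd_Compl:
  assumes "nbhd V E S \<subseteq> X" "S \<subseteq> V"
  shows "nbhd V E (V - X - S) \<subseteq> X"
proof
  fix v assume v: "v \<in> nbhd V E (V - X - S)"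
  then obtain u where u: "u \<in> V - X - S" "{u, v} \<in> E" "v \<in> V" "v \<notin> V - X - S"
    by (auto simp: nbhd_def)
  show "v \<in> X"
  proof (rule ccontr)
    assume "v \<notin> X"
    then have "v \<in> S" using u by blast
    then have "u \<in> nbhd V E S" using u by (auto simp: nbhd_def insert_commute)
    then show False using assms u by blast
  qed
qed

lemma fin_osep_nbhd:
  assumes "S \<subseteq> V" "X \<subseteq> V" "nbhd V E S \<subseteq> X" "finite X"
  shows "fin_osep V E (V - S) (S \<union> X)"
  unfolding fin_osep_def
proof (intro conjI ballI)
  show "V - S \<union> (S \<union> X) = V" using assms by blast
  show "finite ((V - S) \<inter> (S \<union> X))" using assms(4) by (rule finite_subset[rotated]) blast
  fix u v assume uv: "u \<in> V - S - (S \<union> X)" "v \<in> S \<union> X - (V - S)"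
  show "{u, v} \<notin> E"
  proof
    assume "{u, v} \<in> E"
    then have "u \<in> nbhd V E S" using uv assms by (auto simp: nbhd_def insert_commute)
    then show False using uv assms by blast
  qed
qed

lemma fin_osep_nbhd_Diff:
  assumes "fin_osep V E A B"
  shows "nbhd V E (B - A) \<subseteq> A \<inter> B"
proof
  fix v assume "v \<in> nbhd V E (B - A)"
  then obtain u where u: "u \<in> B - A" "{u, v} \<in> E" "v \<in> V" "v \<notin> B - A" by (auto simp: nbhd_def)
  have "{v, u} \<in> E" using u by (simp add: insert_commute)
  then have "v \<notin> A - B" using assms u(1) unfolding fin_osep_def by blast
  then show "v \<in> A \<inter> B" using u assms by (auto simp: fin_osep_def)
qed

section \<open>Ultrafilter calculus for a fixed tangle\<close>

context
  fixes V :: "'a set" and E :: "'a set set" and \<tau> :: "'a osep set"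
  assumes tg: "aleph0_tangle V E \<tau>"
begin

text \<open>Enlarging a separator by finitely many vertices does not change the orientation: if the
  orientations for \<open>nbhd V E S\<close> and for \<open>X\<close> disagreed, intersecting them
  would leave a finite side. Two sets can thus be compared over the union of their
  neighbourhoods.\<close>

lemma big_iff:
  assumes "S \<subseteq> V" "X \<subseteq> V" "nbhd V E S \<subseteq> X" "finite X"
  shows "big V E \<tau> S \<longleftrightarrow> (V - S, S \<union> X) \<in> \<tau>"
proof
  assume "big V E \<tau> S"
  then have "(V - S, S \<union> nbhd V E S) \<in> \<tau>" by (simp add: big_def)
  then show "(V - S, S \<union> X) \<in> \<tau>"
    by (rule tangle_mono[OF tg]) (use assms fin_osep_nbhd[OF assms] in auto)
next
  assume SX: "(V - S, S \<union> X) \<in> \<tau>"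
  have fin: "finite (nbhd V E S)" using assms(3,4) by (rule finite_subset)
  have "(V - S, S \<union> nbhd V E S) \<in> \<tau>"
  proof (rule ccontr)
    assume "\<not> ?thesis"
    then have "(S \<union> nbhd V E S, V - S) \<in> \<tau>"
      using tangle_total[OF tg fin_osep_nbhd[OF assms(1) nbhd_sub order_refl fin]] by blast
    from tangle_infinite[OF tg tangle_Int[OF tg SX this]]
    have "infinite ((S \<union> X) \<inter> (V - S))" .
    moreover have "finite ((S \<union> X) \<inter> (V - S))" using assms(4) by (rule finite_subset[rotated]) blast
    ultimately show False by contradiction
  qed
  then show "big V E \<tau> S" using assms(1) fin by (simp add: big_def)
qed

lemma big_sub: "big V E \<tau> S \<Longrightarrow> S \<subseteq> V"
  by (simp add: big_def)

lemma big_infinite: "big V E \<tau> S \<Longrightarrow> infinite S"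
  using tangle_infinite[OF tg] by (force simp: big_def)

lemma big_mono:
  assumes "big V E \<tau> S" "S \<subseteq> S'" "S' \<subseteq> V" "finite (nbhd V E S')"
  shows "big V E \<tau> S'"
proof -
  let ?X = "nbhd V E S \<union> nbhd V E S'"
  have X: "?X \<subseteq> V" "finite ?X" using assms nbhd_sub[of V E] by (simp_all add: big_def)
  have "(V - S, S \<union> ?X) \<in> \<tau>"
    using big_iff[OF big_sub[OF assms(1)] X(1) _ X(2)] assms(1) by blast
  then have "(V - S', S' \<union> ?X) \<in> \<tau>"
    by (rule tangle_mono[OF tg]) (use assms fin_osep_nbhd[OF assms(3) X(1) _ X(2)] in auto)
  then show ?thesis using big_iff[OF assms(3) X(1) _ X(2)] by blast
qed

lemma big_Int:
  assumes "big V E \<tau> S" "big V E \<tau> S'"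
  shows "big V E \<tau> (S \<inter> S')"
proof -
  let ?X = "nbhd V E S \<union> nbhd V E S'"
  have X: "?X \<subseteq> V" "finite ?X" using assms nbhd_sub[of V E] by (simp_all add: big_def)
  have "(V - S, S \<union> ?X) \<in> \<tau>" "(V - S', S' \<union> ?X) \<in> \<tau>"
    using big_iff[OF big_sub[OF assms(1)] X(1) _ X(2)] big_iff[OF big_sub[OF assms(2)] X(1) _ X(2)]
      assms by blast+
  from tangle_Int[OF tg this]
  have "((V - S) \<union> (V - S'), (S \<union> ?X) \<inter> (S' \<union> ?X)) \<in> \<tau>" .
  moreover have "(V - S) \<union> (V - S') = V - (S \<inter> S')" "(S \<union> ?X) \<inter> (S' \<union> ?X) = S \<inter> S' \<union> ?X"
    by blast+
  ultimately have "(V - (S \<inter> S'), S \<inter> S' \<union> ?X) \<in> \<tau>" by simp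
  moreover have "S \<inter> S' \<subseteq> V" using big_sub[OF assms(1)] by blast
  ultimately show ?thesis using big_iff[OF _ X(1) nbhd_Int X(2)] by blast
qed

lemma big_disjoint:
  assumes "big V E \<tau> S" "big V E \<tau> S'" "S \<inter> S' = {}"
  shows False
  using big_infinite[OF big_Int[OF assms(1,2)]] assms(3) by simp

lemma big_or_compl:
  assumes "S \<subseteq> V" "X \<subseteq> V" "nbhd V E S \<subseteq> X" "finite X"
  shows "big V E \<tau> S \<or> big V E \<tau> (V - X - S)"
proof (rule disjCI)
  assume "\<not> big V E \<tau> (V - X - S)"
  let ?S' = "V - X - S"
  have S': "?S' \<subseteq> V" "nbhd V E ?S' \<subseteq> X" using nbhd_Compl[OF assms(3,1)] by auto
  have "(V - ?S', ?S' \<union> X) \<notin> \<tau>"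
    using big_iff[OF S'(1) assms(2) S'(2) assms(4)] \<open>\<not> big V E \<tau> ?S'\<close> by blast
  moreover have "(V - ?S', ?S' \<union> X) \<in> \<tau>" if "(S \<union> X, V - S) \<in> \<tau>"
    by (rule tangle_mono[OF tg that])
      (use assms fin_osep_nbhd[OF S'(1) assms(2) S'(2) assms(4)] in auto)
  ultimately have "(V - S, S \<union> X) \<in> \<tau>"
    using tangle_total[OF tg fin_osep_nbhd[OF assms]] by blast
  then show "big V E \<tau> S" using big_iff[OF assms] by blast
qed

lemma big_Un:
  assumes "big V E \<tau> (S \<union> S')" "finite (nbhd V E S)" "finite (nbhd V E S')"
  shows "big V E \<tau> S \<or> big V E \<tau> S'"
proof (rule ccontr)
  assume neg: "\<not> ?thesis"
  have S: "S \<subseteq> V" "S' \<subseteq> V" using big_sub[OF assms(1)] by auto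
  have "big V E \<tau> (V - nbhd V E S - S)" "big V E \<tau> (V - nbhd V E S' - S')"
    using big_or_compl[OF S(1) nbhd_sub order_refl assms(2)]
      big_or_compl[OF S(2) nbhd_sub order_refl assms(3)] neg by blast+
  from big_disjoint[OF big_Int[OF this] assms(1)] show False by blast
qed

lemma big_Union:
  assumes "finite \<S>" "big V E \<tau> (\<Union>\<S>)" "\<And>S. S \<in> \<S> \<Longrightarrow> nbhd V E S \<subseteq> X" "finite X"
  shows "\<exists>S\<in>\<S>. big V E \<tau> S"
  using assms(1-3)
proof (induction rule: finite_induct)
  case empty
  then show ?case using big_infinite by force
next
  case (insert S \<S>)
  have "nbhd V E (\<Union>\<S>) \<subseteq> X" using insert.prems(2) by (intro nbhd_Union) blast
  then have "finite (nbhd V E S)" "finite (nbhd V E (\<Union>\<S>))"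
    using insert.prems(2)[of S] assms(4) by (auto intro: finite_subset)
  then have "big V E \<tau> S \<or> big V E \<tau> (\<Union>\<S>)"
    using insert.prems(1) by (intro big_Un) simp_all
  then show ?case using insert.IH insert.prems(2) by blast
qed

lemma tangle_iff_big:
  assumes "fin_osep V E A B"
  shows "(A, B) \<in> \<tau> \<longleftrightarrow> big V E \<tau> (B - A)"
proof -
  have AB: "A \<union> B = V" "\<forall>u\<in>A - B. \<forall>v\<in>B - A. {u, v} \<notin> E" "finite (A \<inter> B)"
    using assms by (auto simp: fin_osep_def)
  note nb = fin_osep_nbhd_Diff[OF assms]
  have "big V E \<tau> (B - A) \<longleftrightarrow> (V - (B - A), (B - A) \<union> A \<inter> B) \<in> \<tau>"
    by (rule big_iff) (use AB nb in auto)
  moreover have "V - (B - A) = A" "(B - A) \<union> A \<inter> B = B" using AB(1) by blast+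
  ultimately show ?thesis by simp
qed

lemma comp_sep_iff_big:
  assumes "\<C> \<subseteq> comps V E X" "finite X" "X \<subseteq> V"
  shows "comp_sep V X \<C> \<in> \<tau> \<longleftrightarrow> big V E \<tau> (\<Union>\<C>)"
proof -
  have "C \<subseteq> V" "nbhd V E C \<subseteq> X" if "C \<in> \<C>" for C
    using subsetD[OF assms(1) that] by (auto simp: comps_iff)
  then have "\<Union>\<C> \<subseteq> V" "nbhd V E (\<Union>\<C>) \<subseteq> X" by (auto intro!: nbhd_Union)
  then show ?thesis
    using big_iff[of "\<Union>\<C>" X] assms by (simp add: comp_sep_def Un_commute)
qed

end

section \<open>Efficient separators\<close>

text \<open>Distinguishing as a property of the vertex set \<open>X\<close> alone, with the side
  left open. The asymmetric form loses nothing, because complementary sides exchange the roles of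
  the tangles.\<close>

definition separates :: "'a set \<Rightarrow> 'a set set \<Rightarrow> 'a osep set \<Rightarrow> 'a osep set \<Rightarrow> 'a set \<Rightarrow> bool" where
  "separates V E \<tau>\<^sub>1 \<tau>\<^sub>2 X \<longleftrightarrow> finite X \<and> X \<subseteq> V \<and>
     (\<exists>S\<subseteq>V - X. nbhd V E S \<subseteq> X \<and> big V E \<tau>\<^sub>1 S \<and> \<not> big V E \<tau>\<^sub>2 S)"

definition efficient :: "'a set \<Rightarrow> 'a set set \<Rightarrow> 'a osep set \<Rightarrow> 'a osep set \<Rightarrow> 'a set \<Rightarrow> bool" where
  "efficient V E \<tau>\<^sub>1 \<tau>\<^sub>2 X \<longleftrightarrow> separates V E \<tau>\<^sub>1 \<tau>\<^sub>2 X \<and>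
     (\<forall>Y. separates V E \<tau>\<^sub>1 \<tau>\<^sub>2 Y \<longrightarrow> card X \<le> card Y)"

lemma big_compl_iff:
  assumes "aleph0_tangle V E \<tau>" "S \<subseteq> V - X" "nbhd V E S \<subseteq> X" "finite X" "X \<subseteq> V"
  shows "big V E \<tau> (V - X - S) \<longleftrightarrow> \<not> big V E \<tau> S"
proof -
  have "S \<subseteq> V" using assms(2) by blast
  from big_or_compl[OF assms(1) this assms(5,3,4)]
  have "big V E \<tau> S \<or> big V E \<tau> (V - X - S)" .
  moreover have "\<not> (big V E \<tau> S \<and> big V E \<tau> (V - X - S))"
    using big_disjoint[OF assms(1), of S "V - X - S"] by blast
  ultimately show ?thesis by blast
qed

lemma separates_commute:
  assumes "aleph0_tangle V E \<tau>\<^sub>1" "aleph0_tangle V E \<tau>\<^sub>2" "separates V E \<tau>\<^sub>1 \<tau>\<^sub>2 X"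
  shows "separates V E \<tau>\<^sub>2 \<tau>\<^sub>1 X"
proof -
  obtain S where X: "finite X" "X \<subseteq> V" and S: "S \<subseteq> V - X" "nbhd V E S \<subseteq> X" "big V E \<tau>\<^sub>1 S" "\<not> big V E \<tau>\<^sub>2 S"
    using assms(3) by (auto simp: separates_def)
  have "V - X - S \<subseteq> V - X" by blast
  moreover have "nbhd V E (V - X - S) \<subseteq> X" using S by (intro nbhd_Compl) auto
  moreover have "big V E \<tau>\<^sub>2 (V - X - S)" "\<not> big V E \<tau>\<^sub>1 (V - X - S)"
    using big_compl_iff[OF assms(1) S(1,2) X] big_compl_iff[OF assms(2) S(1,2) X] S(3,4) by blast+
  ultimately show ?thesis using X unfolding separates_def by blast
qed

lemma separates_iff:
  assumes "aleph0_tangle V E \<tau>\<^sub>1" "aleph0_tangle V E \<tau>\<^sub>2"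
  shows "separates V E \<tau>\<^sub>1 \<tau>\<^sub>2 X \<longleftrightarrow> finite X \<and> X \<subseteq> V \<and>
     (\<exists>S\<subseteq>V - X. nbhd V E S \<subseteq> X \<and> big V E \<tau>\<^sub>1 S \<noteq> big V E \<tau>\<^sub>2 S)"
  using separates_commute[OF assms(2,1)] unfolding separates_def by blast

lemma efficient_commute:
  assumes "aleph0_tangle V E \<tau>\<^sub>1" "aleph0_tangle V E \<tau>\<^sub>2" "efficient V E \<tau>\<^sub>1 \<tau>\<^sub>2 X"
  shows "efficient V E \<tau>\<^sub>2 \<tau>\<^sub>1 X"
  using assms(3) separates_commute[OF assms(1,2)] separates_commute[OF assms(2,1)]
  unfolding efficient_def by blast

lemma comp_sub_closed:
  assumes "C \<in> comps V E X" "C \<inter> S \<noteq> {}" "nbhd V E S \<subseteq> X"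
  shows "C \<subseteq> S"
proof
  fix v assume v: "v \<in> C"
  have C: "connected_graph C E" "C \<subseteq> V - X" using assms(1) by (auto simp: comps_iff)
  obtain u where u: "u \<in> C" "u \<in> S" using assms(2) by blast
  have "(u, v) \<in> linked E C" using C(1) u(1) v by (simp add: connected_graph_def)
  then have "(u, v) \<in> linked E S"
  proof (rule linked_closed[OF _ u(2)])
    fix x y assume "x \<in> S" "y \<in> C" "{x, y} \<in> E"
    then show "y \<in> S" using assms(3) C(2) by (auto simp: nbhd_def)
  qed
  then show "v \<in> S" by (simp add: linked_def)
qed

lemma full_comp_nbhd_Union:
  assumes "\<P> \<subseteq> full_comps V E X"
  shows "nbhd V E (\<Union>\<P>) \<subseteq> X" "\<Union>\<P> \<subseteq> V - X"
proof -
  have *: "C \<subseteq> V - X \<and> nbhd V E C = X" if "C \<in> \<P>" for C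
    using subsetD[OF assms that] by (simp add: full_comps_iff)
  show "nbhd V E (\<Union>\<P>) \<subseteq> X" using * by (intro nbhd_Union) simp
  show "\<Union>\<P> \<subseteq> V - X" using * by (intro Union_least) simp
qed

text \<open>The finitely many neighbourhoods \<open>Y \<subseteq> X\<close> partition the components contained in \<open>S\<close>.\<close>

lemma big_piece:
  assumes tg: "aleph0_tangle V E \<tau>" and S: "big V E \<tau> S" "S \<subseteq> V - X" "nbhd V E S \<subseteq> X" and X: "finite X"
  shows "\<exists>Y\<subseteq>X. big V E \<tau> (\<Union>{C \<in> comps_nbhd V E X Y. C \<subseteq> S})"
proof -
  let ?P = "\<lambda>Y. \<Union>{C \<in> comps_nbhd V E X Y. C \<subseteq> S}"
  have "S \<subseteq> \<Union>(?P ` Pow X)"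
  proof
    fix v assume v: "v \<in> S"
    then have "v \<in> V - X" using S(2) by blast
    from comps_cover[OF this, of E] obtain C where C: "C \<in> comps V E X" "v \<in> C" ..
    have "C \<subseteq> S" by (rule comp_sub_closed[OF C(1) _ S(3)]) (use v C in blast)
    moreover have "nbhd V E C \<in> Pow X" "C \<in> comps_nbhd V E X (nbhd V E C)"
      using C(1) by (auto simp: comps_iff comps_nbhd_def)
    ultimately show "v \<in> \<Union>(?P ` Pow X)" using C(2) by blast
  qed
  then have S_eq: "S = \<Union>(?P ` Pow X)" by auto
  have "\<exists>P\<in>?P ` Pow X. big V E \<tau> P"
  proof (rule big_Union[OF tg _ _ _ X])
    show "finite (?P ` Pow X)" using X by simp
    show "big V E \<tau> (\<Union>(?P ` Pow X))" using S(1) S_eq by simp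
    fix P assume "P \<in> ?P ` Pow X"
    then show "nbhd V E P \<subseteq> X"
      by (auto intro!: nbhd_Union simp: comps_nbhd_def)
  qed
  then show ?thesis by blast
qed

text \<open>Among the components in the distinguishing side, those with one common neighbourhood
  \<open>Y\<close> already form a big set for the first tangle and, being part of that side, not for
  the second. So \<open>Y\<close> separates too, and minimality forces \<open>Y = X\<close>.\<close>

lemma efficient_full:
  assumes tg: "aleph0_tangle V E \<tau>\<^sub>1" "aleph0_tangle V E \<tau>\<^sub>2" and eff: "efficient V E \<tau>\<^sub>1 \<tau>\<^sub>2 X"
  shows "\<exists>\<P>\<subseteq>full_comps V E X. big V E \<tau>\<^sub>1 (\<Union>\<P>) \<and> \<not> big V E \<tau>\<^sub>2 (\<Union>\<P>)"
proof -
  obtain S where X: "finite X" "X \<subseteq> V"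
    and S: "S \<subseteq> V - X" "nbhd V E S \<subseteq> X" "big V E \<tau>\<^sub>1 S" "\<not> big V E \<tau>\<^sub>2 S"
    using eff by (auto simp: efficient_def separates_def)
  obtain Y where Y: "Y \<subseteq> X" "big V E \<tau>\<^sub>1 (\<Union>{C \<in> comps_nbhd V E X Y. C \<subseteq> S})"
    using big_piece[OF tg(1) S(3,1,2) X(1)] by blast
  let ?\<P> = "{C \<in> comps_nbhd V E X Y. C \<subseteq> S}"
  have \<P>: "?\<P> \<subseteq> full_comps V E Y" using comps_nbhd_full by fast
  have np: "\<not> big V E \<tau>\<^sub>2 (\<Union>?\<P>)"
  proof
    assume "big V E \<tau>\<^sub>2 (\<Union>?\<P>)"
    then have "big V E \<tau>\<^sub>2 S"
      by (rule big_mono[OF tg(2)]) (use S X in \<open>auto intro: finite_subset\<close>)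
    then show False using S(4) by contradiction
  qed
  have "finite Y" "Y \<subseteq> V" using Y(1) X by (auto intro: finite_subset)
  then have "separates V E \<tau>\<^sub>1 \<tau>\<^sub>2 Y"
    using full_comp_nbhd_Union[OF \<P>] Y(2) np unfolding separates_def by blast
  then have "card X \<le> card Y" using eff by (simp add: efficient_def)
  then have "Y = X" using Y(1) X(1) by (metis card_seteq)
  then show ?thesis using \<P> Y(2) np by blast
qed

text \<open>Each tangle has a family of full components that is big for it alone. Both families are
  nonempty and they differ, so they cannot consist of one and the same component.\<close>

lemma efficient_tight:
  assumes tg: "aleph0_tangle V E \<tau>\<^sub>1" "aleph0_tangle V E \<tau>\<^sub>2" and eff: "efficient V E \<tau>\<^sub>1 \<tau>\<^sub>2 X"
  shows "tight V E X"
proof -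
  obtain \<P> where P: "\<P> \<subseteq> full_comps V E X" "big V E \<tau>\<^sub>1 (\<Union>\<P>)" "\<not> big V E \<tau>\<^sub>2 (\<Union>\<P>)"
    using efficient_full[OF tg eff] by blast
  obtain \<Q> where Q: "\<Q> \<subseteq> full_comps V E X" "big V E \<tau>\<^sub>2 (\<Union>\<Q>)" "\<not> big V E \<tau>\<^sub>1 (\<Union>\<Q>)"
    using efficient_full[OF tg(2,1) efficient_commute[OF tg eff]] by blast
  have ne: "\<P> \<noteq> {}" "\<Q> \<noteq> {}" using big_infinite[OF tg(1) P(2)] big_infinite[OF tg(2) Q(2)] by auto
  have "\<P> \<noteq> \<Q>" using P Q by auto
  have "\<exists>C\<in>\<P> \<union> \<Q>. \<exists>C'\<in>\<P> \<union> \<Q>. C \<noteq> C'"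
  proof (rule ccontr)
    assume same: "\<not> ?thesis"
    obtain C where C: "C \<in> \<P>" using ne(1) by blast
    have "D = C" if "D \<in> \<P> \<union> \<Q>" for D using same C that by blast
    then have "\<P> = {C}" "\<Q> = {C}" using ne by blast+
    with \<open>\<P> \<noteq> \<Q>\<close> show False by simp
  qed
  moreover have "finite X" using eff by (simp add: efficient_def separates_def)
  ultimately show ?thesis using P(1) Q(1) unfolding tight_def by blast
qed

text \<open>\<open>core \<tau> Z\<close> says that \<open>\<tau>\<close> is an ultrafilter tangle with \<open>X\<^sub>\<tau> = Z\<close>.\<close>

definition core :: "'a set \<Rightarrow> 'a set set \<Rightarrow> 'a osep set \<Rightarrow> 'a set \<Rightarrow> bool" where
  "core V E \<tau> Z \<longleftrightarrow> finite Z \<and> Z \<subseteq> V \<and> big V E \<tau> (\<Union>(full_comps V E Z)) \<and>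
     (\<forall>C\<in>full_comps V E Z. \<not> big V E \<tau> C)"

lemma big_full_comp_mem:
  assumes tg: "aleph0_tangle V E \<tau>" and "big V E \<tau> C" "C \<in> comps V E X" "big V E \<tau> (\<Union>\<P>)" "\<P> \<subseteq> comps V E X"
  shows "C \<in> \<P>"
proof (rule ccontr)
  assume "C \<notin> \<P>"
  have "C \<inter> D = {}" if "D \<in> \<P>" for D
  proof (rule ccontr)
    assume "C \<inter> D \<noteq> {}"
    then have "C = D" by (rule comps_eqI[OF assms(3) subsetD[OF assms(5) that]])
    then show False using that \<open>C \<notin> \<P>\<close> by simp
  qed
  then have "C \<inter> \<Union>\<P> = {}" by blast
  then show False by (rule big_disjoint[OF tg assms(2,4)])
qed

text \<open>If the tangles agree on every full component, neither has a big one: it would belong to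
  the family distinguishing them and make that family big for both. Then \<open>X\<close> is the
  core of both tangles.\<close>

lemma efficient_comp:
  assumes tg: "aleph0_tangle V E \<tau>\<^sub>1" "aleph0_tangle V E \<tau>\<^sub>2" and eff: "efficient V E \<tau>\<^sub>1 \<tau>\<^sub>2 X"
    and ncore: "\<not> (core V E \<tau>\<^sub>1 X \<and> core V E \<tau>\<^sub>2 X)"
  shows "\<exists>C\<in>full_comps V E X. big V E \<tau>\<^sub>1 C \<noteq> big V E \<tau>\<^sub>2 C"
proof (rule ccontr)
  assume "\<not> ?thesis"
  then have same: "big V E \<tau>\<^sub>1 C = big V E \<tau>\<^sub>2 C" if "C \<in> full_comps V E X" for C
    using that by blast
  have X: "finite X" "X \<subseteq> V" using eff by (auto simp: efficient_def separates_def)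
  obtain \<P> where P: "\<P> \<subseteq> full_comps V E X" "big V E \<tau>\<^sub>1 (\<Union>\<P>)" "\<not> big V E \<tau>\<^sub>2 (\<Union>\<P>)"
    using efficient_full[OF tg eff] by blast
  obtain \<Q> where Q: "\<Q> \<subseteq> full_comps V E X" "big V E \<tau>\<^sub>2 (\<Union>\<Q>)" "\<not> big V E \<tau>\<^sub>1 (\<Union>\<Q>)"
    using efficient_full[OF tg(2,1) efficient_commute[OF tg eff]] by blast
  have fin: "finite (nbhd V E (\<Union>\<R>))" "\<Union>\<R> \<subseteq> V" if "\<R> \<subseteq> full_comps V E X" for \<R>
    using full_comp_nbhd_Union[OF that] X by (auto intro: finite_subset)
  have none: "\<not> big V E \<tau>\<^sub>1 C" if C: "C \<in> full_comps V E X" for C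
  proof
    assume b: "big V E \<tau>\<^sub>1 C"
    have "\<P> \<subseteq> comps V E X" using P(1) full_comps_comps by fast
    from big_full_comp_mem[OF tg(1) b full_comps_comps[OF C] P(2) this] have "C \<in> \<P>" .
    then have "C \<subseteq> \<Union>\<P>" by blast
    have "big V E \<tau>\<^sub>2 C" using same[OF C] b by simp
    from big_mono[OF tg(2) this \<open>C \<subseteq> \<Union>\<P>\<close>] have "big V E \<tau>\<^sub>2 (\<Union>\<P>)" using fin[OF P(1)] by blast
    then show False using P(3) by contradiction
  qed
  have "big V E \<tau>\<^sub>1 (\<Union>(full_comps V E X))"
    by (rule big_mono[OF tg(1) P(2) Union_mono[OF P(1)] fin(2,1)]) simp_all
  moreover have "big V E \<tau>\<^sub>2 (\<Union>(full_comps V E X))"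
    by (rule big_mono[OF tg(2) Q(2) Union_mono[OF Q(1)] fin(2,1)]) simp_all
  ultimately have "core V E \<tau>\<^sub>1 X" "core V E \<tau>\<^sub>2 X"
    using none same X by (auto simp: core_def)
  then show False using ncore by blast
qed

section \<open>Equivalent tangles\<close>

text \<open>Only finitely many full components meet the finite set \<open>X\<close>. Were their
  union big, one of them would be big, which a core forbids.\<close>

lemma core_avoiding:
  assumes tg: "aleph0_tangle V E \<tau>" and core: "core V E \<tau> Z" and X: "finite X"
  shows "big V E \<tau> (\<Union>{C \<in> full_comps V E Z. C \<inter> X = {}})"
proof (rule ccontr)
  assume neg: "\<not> ?thesis"
  let ?F = "{C \<in> full_comps V E Z. C \<inter> X = {}}" and ?G = "{C \<in> full_comps V E Z. C \<inter> X \<noteq> {}}"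
  have Z: "finite Z" "big V E \<tau> (\<Union>(full_comps V E Z))" and nb: "\<And>C. C \<in> full_comps V E Z \<Longrightarrow> \<not> big V E \<tau> C"
    using core by (auto simp: core_def)
  have FG: "?F \<subseteq> full_comps V E Z" "?G \<subseteq> full_comps V E Z" by auto
  have fin: "finite (nbhd V E (\<Union>?F))" "finite (nbhd V E (\<Union>?G))"
    using full_comp_nbhd_Union(1)[OF FG(1)] full_comp_nbhd_Union(1)[OF FG(2)] Z(1)
    by (auto intro: finite_subset)
  have "full_comps V E Z = ?F \<union> ?G" by blast
  then have "\<Union>(full_comps V E Z) = \<Union>?F \<union> \<Union>?G" by (metis Union_Un_distrib)
  with Z(2) have "big V E \<tau> (\<Union>?F \<union> \<Union>?G)" by simp
  from big_Un[OF tg this fin] neg have bG: "big V E \<tau> (\<Union>?G)" by blast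
  have "finite ?G"
  proof (rule inj_on_finite)
    let ?f = "\<lambda>C. SOME x. x \<in> C \<inter> X"
    have f: "?f C \<in> C \<inter> X" if "C \<in> ?G" for C
      using that some_in_eq[of "C \<inter> X"] by simp
    show "inj_on ?f ?G"
    proof (rule inj_onI)
      fix C D assume CD: "C \<in> ?G" "D \<in> ?G" "?f C = ?f D"
      then have "C \<inter> D \<noteq> {}" using f[OF CD(1)] f[OF CD(2)] by auto
      then show "C = D" using CD comps_eqI[of C V E Z D] by (auto dest: full_comps_comps)
    qed
    show "?f ` ?G \<subseteq> X" using f by blast
  qed (rule X)
  then have "\<exists>C\<in>?G. big V E \<tau> C"
    by (rule big_Union[OF tg _ bG _ Z(1)]) (auto simp: full_comps_iff)
  then show False using nb by blast
qed

text \<open>The full components of each core that avoid the other form two big unions, which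
  intersect. Two intersecting components of this kind contain each other, hence are equal and have
  the same neighbourhood.\<close>

lemma core_unique:
  assumes tg: "aleph0_tangle V E \<tau>" and Y: "core V E \<tau> Y" and Z: "core V E \<tau> Z"
  shows "Y = Z"
proof -
  have "finite Y" "finite Z" using Y Z by (auto simp: core_def)
  then have "big V E \<tau> (\<Union>{C \<in> full_comps V E Y. C \<inter> Z = {}})"
    "big V E \<tau> (\<Union>{C \<in> full_comps V E Z. C \<inter> Y = {}})"
    using core_avoiding[OF tg Y] core_avoiding[OF tg Z] by auto
  from big_disjoint[OF tg this] obtain C D where CD: "C \<in> full_comps V E Y" "C \<inter> Z = {}"
    "D \<in> full_comps V E Z" "D \<inter> Y = {}" "C \<inter> D \<noteq> {}" by blast
  have C: "connected_graph C E" "C \<subseteq> V" "nbhd V E C = Y" and D: "connected_graph D E" "D \<subseteq> V" "nbhd V E D = Z"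
    using CD by (auto simp: full_comps_iff)
  have "C \<subseteq> D" by (rule connected_subset_comp[OF C(1,2) CD(2) full_comps_comps[OF CD(3)] CD(5)])
  moreover have "D \<subseteq> C"
    by (rule connected_subset_comp[OF D(1,2) CD(4) full_comps_comps[OF CD(1)]]) (use CD(5) in blast)
  ultimately show ?thesis using C D by simp
qed

section \<open>Cores and free ultrafilters on components\<close>

lemma tangle_ultrafilter_eq:
  assumes "aleph0_tangle V E \<tau>" "finite X" "X \<subseteq> V"
  shows "tangle_ultrafilter V E \<tau> X = {\<C>. \<C> \<subseteq> comps V E X \<and> big V E \<tau> (\<Union>\<C>)}"
  using comp_sep_iff_big[OF assms(1) _ assms(2,3)] unfolding tangle_ultrafilter_def by blast

lemma comps_Union:
  assumes "\<C> \<subseteq> comps V E X"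
  shows "\<Union>\<C> \<subseteq> V - X" "nbhd V E (\<Union>\<C>) \<subseteq> X"
proof -
  have *: "C \<subseteq> V - X \<and> nbhd V E C \<subseteq> X" if "C \<in> \<C>" for C
    using subsetD[OF assms that] by (simp add: comps_iff)
  show "\<Union>\<C> \<subseteq> V - X" using * by (intro Union_least) simp
  show "nbhd V E (\<Union>\<C>) \<subseteq> X" using * by (intro nbhd_Union) simp
qed

lemma comps_Union_Int:
  assumes "\<A> \<subseteq> comps V E X" "\<B> \<subseteq> comps V E X"
  shows "\<Union>(\<A> \<inter> \<B>) = \<Union>\<A> \<inter> \<Union>\<B>"
proof
  show "\<Union>\<A> \<inter> \<Union>\<B> \<subseteq> \<Union>(\<A> \<inter> \<B>)"
  proof
    fix v assume "v \<in> \<Union>\<A> \<inter> \<Union>\<B>"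
    then obtain A B where AB: "A \<in> \<A>" "B \<in> \<B>" "v \<in> A" "v \<in> B" by blast
    then have "A = B" by (intro comps_eqI[of A V E X B]) (use assms in auto)
    with AB show "v \<in> \<Union>(\<A> \<inter> \<B>)" by blast
  qed
qed blast

lemma comps_Union_Diff:
  assumes "\<A> \<subseteq> comps V E X"
  shows "\<Union>(comps V E X - \<A>) = V - X - \<Union>\<A>"
proof
  have "\<Union>(comps V E X - \<A>) \<inter> \<Union>\<A> = {}"
    using comps_Union_Int[of "comps V E X - \<A>" V E X \<A>] assms by auto
  moreover have "\<Union>(comps V E X - \<A>) \<subseteq> V - X" by (rule comps_Union) blast
  ultimately show "\<Union>(comps V E X - \<A>) \<subseteq> V - X - \<Union>\<A>" by blast
  show "V - X - \<Union>\<A> \<subseteq> \<Union>(comps V E X - \<A>)"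
    using comps_cover[of _ V X E] by blast
qed

lemma tangle_ultrafilter_ultrafilter:
  assumes tg: "aleph0_tangle V E \<tau>" and X: "finite X" "X \<subseteq> V"
  shows "ultrafilter_on (comps V E X) (tangle_ultrafilter V E \<tau> X)"
  unfolding ultrafilter_on_def tangle_ultrafilter_eq[OF assms]
proof (intro conjI ballI allI impI)
  have fin: "finite (nbhd V E (\<Union>\<C>))" "\<Union>\<C> \<subseteq> V" if "\<C> \<subseteq> comps V E X" for \<C>
    using comps_Union[OF that] X by (auto intro: finite_subset)
  have or: "big V E \<tau> (\<Union>\<A>) \<or> big V E \<tau> (\<Union>(comps V E X - \<A>))" if "\<A> \<subseteq> comps V E X" for \<A>
    unfolding comps_Union_Diff[OF that]
    by (rule big_or_compl[OF tg fin(2)[OF that] X(2) comps_Union(2)[OF that] X(1)])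
  have empty: "\<not> big V E \<tau> (\<Union>{})" using big_infinite[OF tg, of "{}"] by auto
  show "{\<C>. \<C> \<subseteq> comps V E X \<and> big V E \<tau> (\<Union>\<C>)} \<subseteq> Pow (comps V E X)" by blast
  show "{} \<notin> {\<C>. \<C> \<subseteq> comps V E X \<and> big V E \<tau> (\<Union>\<C>)}" using empty by simp
  show "comps V E X \<in> {\<C>. \<C> \<subseteq> comps V E X \<and> big V E \<tau> (\<Union>\<C>)}"
    using or[of "{}"] empty by simp
  show "\<A> \<inter> \<B> \<in> {\<C>. \<C> \<subseteq> comps V E X \<and> big V E \<tau> (\<Union>\<C>)}"
    if "\<A> \<in> {\<C>. \<C> \<subseteq> comps V E X \<and> big V E \<tau> (\<Union>\<C>)}" "\<B> \<in> {\<C>. \<C> \<subseteq> comps V E X \<and> big V E \<tau> (\<Union>\<C>)}" for \<A> \<B>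
  proof -
    have AB: "\<A> \<subseteq> comps V E X" "\<B> \<subseteq> comps V E X" "big V E \<tau> (\<Union>\<A>)" "big V E \<tau> (\<Union>\<B>)"
      using that by simp_all
    have "big V E \<tau> (\<Union>(\<A> \<inter> \<B>))"
      unfolding comps_Union_Int[OF AB(1,2)] by (rule big_Int[OF tg AB(3,4)])
    then show ?thesis using AB(1) by (auto simp del: Union_iff)
  qed
  show "\<B> \<in> {\<C>. \<C> \<subseteq> comps V E X \<and> big V E \<tau> (\<Union>\<C>)}"
    if "\<A> \<in> {\<C>. \<C> \<subseteq> comps V E X \<and> big V E \<tau> (\<Union>\<C>)}" "\<B> \<subseteq> comps V E X" "\<A> \<subseteq> \<B>" for \<A> \<B>
  proof -
    have "big V E \<tau> (\<Union>\<A>)" using that by simp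
    from big_mono[OF tg this Union_mono[OF that(3)] fin(2,1)[OF that(2)]] that(2)
    show ?thesis by simp
  qed
  show "\<A> \<in> {\<C>. \<C> \<subseteq> comps V E X \<and> big V E \<tau> (\<Union>\<C>)} \<or>
      comps V E X - \<A> \<in> {\<C>. \<C> \<subseteq> comps V E X \<and> big V E \<tau> (\<Union>\<C>)}" if "\<A> \<subseteq> comps V E X" for \<A>
    using or[OF that] that by (simp add: Diff_subset)
qed

lemma core_free_at:
  assumes tg: "aleph0_tangle V E \<tau>" and core: "core V E \<tau> Z"
  shows "free_at V E \<tau> Z"
proof -
  have Z: "finite Z" "Z \<subseteq> V" "big V E \<tau> (\<Union>(full_comps V E Z))"
    and nb: "\<And>C. C \<in> full_comps V E Z \<Longrightarrow> \<not> big V E \<tau> C"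
    using core by (auto simp: core_def)
  note uf = tangle_ultrafilter_ultrafilter[OF tg Z(1,2)]
  have F: "full_comps V E Z \<in> tangle_ultrafilter V E \<tau> Z"
    unfolding tangle_ultrafilter_eq[OF tg Z(1,2)] using Z(3) full_comps_comps by fast
  have "\<exists>\<A>\<in>tangle_ultrafilter V E \<tau> Z. C \<notin> \<A>" for C
  proof (cases "C \<in> full_comps V E Z")
    case True
    then have C: "{C} \<subseteq> comps V E Z" using full_comps_comps by fast
    have "{C} \<notin> tangle_ultrafilter V E \<tau> Z"
      unfolding tangle_ultrafilter_eq[OF tg Z(1,2)] using nb[OF True] by simp
    then have "comps V E Z - {C} \<in> tangle_ultrafilter V E \<tau> Z"
      using uf C unfolding ultrafilter_on_def by blast
    then show ?thesis by blast
  next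
    case False
    then show ?thesis using F by blast
  qed
  then have "\<Inter>(tangle_ultrafilter V E \<tau> Z) = {}" by blast
  then show ?thesis using uf Z(1,2) by (simp add: free_at_def free_ultrafilter_on_def)
qed

text \<open>The ultrafilter at \<open>X\<close> concentrates on components with one common
  neighbourhood \<open>Y\<close>. A big full component of \<open>G - Y\<close> would be one of
  these, hence a component of \<open>G - X\<close> contained in every member of the ultrafilter,
  against freeness.\<close>

lemma free_at_core:
  assumes tg: "aleph0_tangle V E \<tau>" and free: "free_at V E \<tau> X"
  shows "\<exists>Y\<subseteq>X. core V E \<tau> Y"
proof -
  have X: "finite X" "X \<subseteq> V" and emp: "\<Inter>(tangle_ultrafilter V E \<tau> X) = {}"
    and uf: "ultrafilter_on (comps V E X) (tangle_ultrafilter V E \<tau> X)"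
    using free by (auto simp: free_at_def free_ultrafilter_on_def)
  note eq = tangle_ultrafilter_eq[OF tg X]
  have "big V E \<tau> (\<Union>(comps V E X))"
    using uf unfolding ultrafilter_on_def eq by blast
  from big_piece[OF tg this comps_Union[OF order_refl] X(1)]
  obtain Y where Y: "Y \<subseteq> X" "big V E \<tau> (\<Union>{C \<in> comps_nbhd V E X Y. C \<subseteq> \<Union>(comps V E X)})" by blast
  let ?\<P> = "{C \<in> comps_nbhd V E X Y. C \<subseteq> \<Union>(comps V E X)}"
  have \<P>: "?\<P> \<subseteq> full_comps V E Y" using comps_nbhd_full by fast
  have \<P>X: "?\<P> \<subseteq> comps V E X" by (auto simp: comps_nbhd_def)
  have Yfin: "finite Y" "Y \<subseteq> V" using Y(1) X by (auto intro: finite_subset)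
  have "big V E \<tau> (\<Union>(full_comps V E Y))"
    using full_comp_nbhd_Union[OF order_refl, of V E Y] Yfin
    by (intro big_mono[OF tg Y(2) Union_mono[OF \<P>]]) (auto intro: finite_subset)
  moreover have "\<not> big V E \<tau> C" if C: "C \<in> full_comps V E Y" for C
  proof
    assume b: "big V E \<tau> C"
    have "?\<P> \<subseteq> comps V E Y" using \<P> full_comps_comps by fast
    from big_full_comp_mem[OF tg b full_comps_comps[OF C] Y(2) this] have "C \<in> ?\<P>" .
    then have CX: "C \<in> comps V E X" using \<P>X by blast
    obtain \<A> where A: "\<A> \<in> tangle_ultrafilter V E \<tau> X" "C \<notin> \<A>" using emp by blast
    then have "\<A> \<subseteq> comps V E X" "big V E \<tau> (\<Union>\<A>)" unfolding eq by blast+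
    from big_full_comp_mem[OF tg b CX this(2,1)] A(2) show False by contradiction
  qed
  ultimately have "core V E \<tau> Y" using Yfin by (simp add: core_def)
  then show ?thesis using Y(1) by blast
qed

text \<open>The least set exists because every \<open>X\<close> at which the ultrafilter is free
  contains a core, and the core is unique.\<close>

lemma core_X_of:
  assumes tg: "aleph0_tangle V E \<tau>" and core: "core V E \<tau> Z"
  shows "ultrafilter_tangle V E \<tau>" "X_of V E \<tau> = Z"
proof -
  show "ultrafilter_tangle V E \<tau>"
    using core_free_at[OF assms] tg unfolding ultrafilter_tangle_def by blast
  show "X_of V E \<tau> = Z"
    unfolding X_of_def
  proof (rule Least_equality)
    show "free_at V E \<tau> Z" by (rule core_free_at[OF assms])
    fix X assume "free_at V E \<tau> X"
    from free_at_core[OF tg this] core_unique[OF tg core] show "Z \<subseteq> X" by blast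
  qed
qed

lemma equivalent_tangles_iff:
  assumes "aleph0_tangle V E \<tau>\<^sub>1" "aleph0_tangle V E \<tau>\<^sub>2"
  shows "equivalent_tangles V E \<tau>\<^sub>1 \<tau>\<^sub>2 \<longleftrightarrow> (\<exists>Z. core V E \<tau>\<^sub>1 Z \<and> core V E \<tau>\<^sub>2 Z)"
proof
  assume eq: "equivalent_tangles V E \<tau>\<^sub>1 \<tau>\<^sub>2"
  then obtain X\<^sub>1 X\<^sub>2 where "free_at V E \<tau>\<^sub>1 X\<^sub>1" "free_at V E \<tau>\<^sub>2 X\<^sub>2"
    by (auto simp: equivalent_tangles_def ultrafilter_tangle_def)
  then obtain Y\<^sub>1 Y\<^sub>2 where Y: "core V E \<tau>\<^sub>1 Y\<^sub>1" "core V E \<tau>\<^sub>2 Y\<^sub>2"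
    using free_at_core[OF assms(1)] free_at_core[OF assms(2)] by blast
  have "X_of V E \<tau>\<^sub>1 = X_of V E \<tau>\<^sub>2" using eq by (simp add: equivalent_tangles_def)
  then have "Y\<^sub>1 = Y\<^sub>2" using core_X_of(2)[OF assms(1) Y(1)] core_X_of(2)[OF assms(2) Y(2)] by simp
  then show "\<exists>Z. core V E \<tau>\<^sub>1 Z \<and> core V E \<tau>\<^sub>2 Z" using Y by blast
next
  assume "\<exists>Z. core V E \<tau>\<^sub>1 Z \<and> core V E \<tau>\<^sub>2 Z"
  then obtain Z where Z: "core V E \<tau>\<^sub>1 Z" "core V E \<tau>\<^sub>2 Z" by blast
  show "equivalent_tangles V E \<tau>\<^sub>1 \<tau>\<^sub>2"
    unfolding equivalent_tangles_def
    using core_X_of[OF assms(1) Z(1)] core_X_of[OF assms(2) Z(2)] by simp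
qed

section \<open>Uncrossing\<close>

definition side :: "'a set \<Rightarrow> 'a set set \<Rightarrow> 'a set \<Rightarrow> 'a set \<Rightarrow> bool" where
  "side V E X a \<longleftrightarrow> finite X \<and> X \<subseteq> V \<and> a \<subseteq> V - X \<and> nbhd V E a \<subseteq> X"

lemma side_compl: "side V E X a \<Longrightarrow> side V E X (V - X - a)"
  unfolding side_def using nbhd_Compl[of V E a X] by blast

lemma side_compl_compl: "side V E X a \<Longrightarrow> V - X - (V - X - a) = a"
  by (auto simp: side_def)

lemma big_side_compl:
  assumes "aleph0_tangle V E \<tau>" "side V E X a"
  shows "big V E \<tau> (V - X - a) \<longleftrightarrow> \<not> big V E \<tau> a"
  using assms by (intro big_compl_iff) (auto simp: side_def)

lemma big_side_Int:
  assumes tg: "aleph0_tangle V E \<tau>" and "side V E X a" "side V E Y d"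
  shows "big V E \<tau> (a \<inter> d) \<longleftrightarrow> big V E \<tau> a \<and> big V E \<tau> d"
proof
  assume b: "big V E \<tau> (a \<inter> d)"
  have "a \<subseteq> V" "finite (nbhd V E a)" "d \<subseteq> V" "finite (nbhd V E d)"
    using assms(2,3) by (auto simp: side_def intro: finite_subset)
  then show "big V E \<tau> a \<and> big V E \<tau> d"
    using big_mono[OF tg b] by blast
qed (use big_Int[OF tg] in blast)

lemma side_corner:
  assumes "side V E X a" "side V E Y d"
  shows "side V E (corner X Y a d) (a \<inter> d)"
  unfolding side_def
proof (intro conjI)
  show "finite (corner X Y a d)" "corner X Y a d \<subseteq> V" "a \<inter> d \<subseteq> V - corner X Y a d"
    using assms by (auto simp: side_def corner_def)
  show "nbhd V E (a \<inter> d) \<subseteq> corner X Y a d"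
    using assms by (auto simp: side_def corner_def nbhd_def)
qed

lemma corner_separates:
  assumes "aleph0_tangle V E \<tau>\<^sub>1" "aleph0_tangle V E \<tau>\<^sub>2" "side V E X a" "side V E Y d"
    and "(big V E \<tau>\<^sub>1 a \<and> big V E \<tau>\<^sub>1 d) \<noteq> (big V E \<tau>\<^sub>2 a \<and> big V E \<tau>\<^sub>2 d)"
  shows "separates V E \<tau>\<^sub>1 \<tau>\<^sub>2 (corner X Y a d)"
proof -
  have "big V E \<tau>\<^sub>1 (a \<inter> d) \<noteq> big V E \<tau>\<^sub>2 (a \<inter> d)"
    using assms(5) big_side_Int[OF assms(1,3,4)] big_side_Int[OF assms(2,3,4)] by simp
  then show ?thesis
    using side_corner[OF assms(3,4)] unfolding separates_iff[OF assms(1,2)] side_def by blast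
qed

lemma card_corners:
  assumes "side V E X a" "side V E Y d"
  shows "card (corner X Y a d) + card (corner X Y (V - X - a) (V - Y - d)) \<le> card X + card Y"
    (is "card ?c + card ?c' \<le> _")
proof -
  have fin: "finite X" "finite Y" using assms by (simp_all add: side_def)
  then have finc: "finite ?c" "finite ?c'" by (simp_all add: corner_def)
  have "card (?c \<union> ?c') \<le> card (X \<union> Y)" "card (?c \<inter> ?c') \<le> card (X \<inter> Y)"
    using fin by (auto intro!: card_mono simp: corner_def)
  then show ?thesis
    using card_Un_Int[OF finc] card_Un_Int[OF fin] by linarith
qed

text \<open>Each corner has at least the minimum order for its pair, and submodularity leaves no
  slack.\<close>

lemma efficient_corners:
  assumes "efficient V E \<tau>\<^sub>1 \<tau>\<^sub>2 X" "efficient V E \<sigma>\<^sub>1 \<sigma>\<^sub>2 Y" "side V E X a" "side V E Y d"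
    and "separates V E \<tau>\<^sub>1 \<tau>\<^sub>2 (corner X Y a d)" "separates V E \<sigma>\<^sub>1 \<sigma>\<^sub>2 (corner X Y (V - X - a) (V - Y - d))"
  shows "efficient V E \<tau>\<^sub>1 \<tau>\<^sub>2 (corner X Y a d)"
    "efficient V E \<sigma>\<^sub>1 \<sigma>\<^sub>2 (corner X Y (V - X - a) (V - Y - d))"
proof -
  have "card X \<le> card (corner X Y a d)" "card Y \<le> card (corner X Y (V - X - a) (V - Y - d))"
    using assms(1,2,5,6) by (auto simp: efficient_def)
  then have "card (corner X Y a d) = card X" "card (corner X Y (V - X - a) (V - Y - d)) = card Y"
    using card_corners[OF assms(3,4)] by linarith+
  then show "efficient V E \<tau>\<^sub>1 \<tau>\<^sub>2 (corner X Y a d)"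
    "efficient V E \<sigma>\<^sub>1 \<sigma>\<^sub>2 (corner X Y (V - X - a) (V - Y - d))"
    using assms(1,2,5,6) unfolding efficient_def by simp_all
qed

lemma uncross_agreeing:
  assumes tg: "aleph0_tangle V E \<tau>\<^sub>1" "aleph0_tangle V E \<tau>\<^sub>2" "aleph0_tangle V E \<sigma>\<^sub>1" "aleph0_tangle V E \<sigma>\<^sub>2"
    and a: "side V E X a" "big V E \<tau>\<^sub>1 a \<noteq> big V E \<tau>\<^sub>2 a"
    and d: "side V E Y d" "big V E \<sigma>\<^sub>1 d \<noteq> big V E \<sigma>\<^sub>2 d" "big V E \<tau>\<^sub>1 d = big V E \<tau>\<^sub>2 d"
  shows "\<exists>a'\<in>{a, V - X - a}. \<exists>d'\<in>{d, V - Y - d}. separates V E \<tau>\<^sub>1 \<tau>\<^sub>2 (corner X Y a' d') \<and>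
    separates V E \<sigma>\<^sub>1 \<sigma>\<^sub>2 (corner X Y (V - X - a') (V - Y - d'))"
proof -
  \<comment> \<open>The side of \<open>Y\<close> that is big for both of
    \<open>\<tau>\<^sub>1\<close> and \<open>\<tau>\<^sub>2\<close>, so that intersecting with it
    keeps them distinguished.\<close>
  define d' where "d' = (if big V E \<tau>\<^sub>1 d then d else V - Y - d)"
  have d': "d' \<in> {d, V - Y - d}" by (simp add: d'_def)
  have sd: "side V E Y d'" using d(1) side_compl[OF d(1)] by (simp add: d'_def)
  have bd: "big V E \<tau>\<^sub>1 d'" "big V E \<tau>\<^sub>2 d'" "big V E \<sigma>\<^sub>1 d' \<noteq> big V E \<sigma>\<^sub>2 d'"
    using d(2,3) big_side_compl[OF tg(1) d(1)] big_side_compl[OF tg(2) d(1)]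
      big_side_compl[OF tg(3) d(1)] big_side_compl[OF tg(4) d(1)] by (auto simp: d'_def)
  \<comment> \<open>The tangle of the second pair that lives opposite \<open>d'\<close>. The side
    \<open>a'\<close> is then chosen so that \<open>\<sigma>\<close> lives opposite it too; the
    opposite corner is big for \<open>\<sigma>\<close> and not for its partner, which lives in
    \<open>d'\<close>.\<close>
  define \<sigma> where "\<sigma> = (if big V E \<sigma>\<^sub>1 d' then \<sigma>\<^sub>2 else \<sigma>\<^sub>1)"
  define a' where "a' = (if big V E \<sigma> a then V - X - a else a)"
  have tg\<sigma>: "aleph0_tangle V E \<sigma>" using tg by (simp add: \<sigma>_def)
  have a': "a' \<in> {a, V - X - a}" by (simp add: a'_def)
  have sa: "side V E X a'" using a(1) side_compl[OF a(1)] by (simp add: a'_def)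
  have ba: "big V E \<tau>\<^sub>1 a' \<noteq> big V E \<tau>\<^sub>2 a'" "\<not> big V E \<sigma> a'"
    using a(2) big_side_compl[OF tg(1) a(1)] big_side_compl[OF tg(2) a(1)]
      big_side_compl[OF tg\<sigma> a(1)] by (auto simp: a'_def)
  have "separates V E \<tau>\<^sub>1 \<tau>\<^sub>2 (corner X Y a' d')"
    by (rule corner_separates[OF tg(1,2) sa sd]) (use ba bd in simp)
  moreover have "separates V E \<sigma>\<^sub>1 \<sigma>\<^sub>2 (corner X Y (V - X - a') (V - Y - d'))"
    by (rule corner_separates[OF tg(3,4) side_compl[OF sa] side_compl[OF sd]])
      (use ba bd big_side_compl[OF tg(3) sa] big_side_compl[OF tg(4) sa]
        big_side_compl[OF tg(3) sd] big_side_compl[OF tg(4) sd] in \<open>auto simp: \<sigma>_def split: if_splits\<close>)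
  ultimately show ?thesis using a' d' by blast
qed

text \<open>If one of the separators does not separate the other pair by the given side, its side
  tells which opposite corners to take. Otherwise each separator serves both pairs, so the orders
  agree, and the corners are placed with regard to the first pair only.\<close>

lemma uncross_opposite_corners:
  assumes tg: "aleph0_tangle V E \<tau>\<^sub>1" "aleph0_tangle V E \<tau>\<^sub>2" "aleph0_tangle V E \<sigma>\<^sub>1" "aleph0_tangle V E \<sigma>\<^sub>2"
    and X: "efficient V E \<tau>\<^sub>1 \<tau>\<^sub>2 X" and Y: "efficient V E \<sigma>\<^sub>1 \<sigma>\<^sub>2 Y" and card: "card Y \<le> card X"
    and a: "side V E X a" "big V E \<tau>\<^sub>1 a \<noteq> big V E \<tau>\<^sub>2 a"
    and d: "side V E Y d" "big V E \<sigma>\<^sub>1 d \<noteq> big V E \<sigma>\<^sub>2 d"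
  shows "\<exists>a'\<in>{a, V - X - a}. \<exists>d'\<in>{d, V - Y - d}. \<exists>c c'. c = corner X Y a' d' \<and>
    c' = corner X Y (V - X - a') (V - Y - d') \<and>
    (efficient V E \<tau>\<^sub>1 \<tau>\<^sub>2 c \<and> efficient V E \<sigma>\<^sub>1 \<sigma>\<^sub>2 c' \<or>
     card X = card Y \<and> efficient V E \<tau>\<^sub>1 \<tau>\<^sub>2 c \<and> efficient V E \<tau>\<^sub>1 \<tau>\<^sub>2 c' \<and>
       efficient V E \<tau>\<^sub>1 \<tau>\<^sub>2 Y \<and> efficient V E \<sigma>\<^sub>1 \<sigma>\<^sub>2 X)"
proof -
  have sa: "side V E X a'" if "a' \<in> {a, V - X - a}" for a'
    using that a(1) side_compl[OF a(1)] by auto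
  have sd: "side V E Y d'" if "d' \<in> {d, V - Y - d}" for d'
    using that d(1) side_compl[OF d(1)] by auto
  show ?thesis
  proof (cases "big V E \<tau>\<^sub>1 d = big V E \<tau>\<^sub>2 d")
    case True
    obtain a' d' where a': "a' \<in> {a, V - X - a}" and d': "d' \<in> {d, V - Y - d}"
      and sep: "separates V E \<tau>\<^sub>1 \<tau>\<^sub>2 (corner X Y a' d')"
        "separates V E \<sigma>\<^sub>1 \<sigma>\<^sub>2 (corner X Y (V - X - a') (V - Y - d'))"
      using uncross_agreeing[OF tg a d True] by blast
    show ?thesis
      using efficient_corners[OF X Y sa[OF a'] sd[OF d'] sep] a' d' by blast
  next
    case False
    then have Y\<tau>: "separates V E \<tau>\<^sub>1 \<tau>\<^sub>2 Y"
      using d(1) unfolding separates_iff[OF tg(1,2)] side_def by blast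
    then have eq: "card X = card Y" using X card by (simp add: efficient_def antisym)
    show ?thesis
    proof (cases "big V E \<sigma>\<^sub>1 a = big V E \<sigma>\<^sub>2 a")
      case True
      obtain a' d' where a': "a' \<in> {a, V - X - a}" and d': "d' \<in> {d, V - Y - d}"
        and sep: "separates V E \<sigma>\<^sub>1 \<sigma>\<^sub>2 (corner Y X d' a')"
          "separates V E \<tau>\<^sub>1 \<tau>\<^sub>2 (corner Y X (V - Y - d') (V - X - a'))"
        using uncross_agreeing[OF tg(3,4,1,2) d a True] by blast
      note s = sa[OF a'] sd[OF d']
      have c: "corner Y X d' a' = corner X Y (V - X - (V - X - a')) (V - Y - (V - Y - d'))"
        "corner Y X (V - Y - d') (V - X - a') = corner X Y (V - X - a') (V - Y - d')"
        using side_compl_compl[OF s(1)] side_compl_compl[OF s(2)] corner_commute by metis+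
      have "V - X - a' \<in> {a, V - X - a}" "V - Y - d' \<in> {d, V - Y - d}"
        using a' d' side_compl_compl[OF a(1)] side_compl_compl[OF d(1)] by auto
      then show ?thesis
        using efficient_corners[OF X Y side_compl[OF s(1)] side_compl[OF s(2)] sep(2)[unfolded c] sep(1)[unfolded c]]
        by blast
    next
      case False': False
      then have "separates V E \<sigma>\<^sub>1 \<sigma>\<^sub>2 X"
        using a(1) unfolding separates_iff[OF tg(3,4)] side_def by blast
      with Y\<tau> eq X Y have eff: "efficient V E \<tau>\<^sub>1 \<tau>\<^sub>2 Y" "efficient V E \<sigma>\<^sub>1 \<sigma>\<^sub>2 X"
        by (simp_all add: efficient_def)
      \<comment> \<open>\<open>\<tau>\<^sub>1\<close> lives in both chosen sides and
        \<open>\<tau>\<^sub>2\<close> in neither, so either of the opposite corners distinguishes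
        them.\<close>
      define a' where "a' = (if big V E \<tau>\<^sub>1 a then a else V - X - a)"
      define d' where "d' = (if big V E \<tau>\<^sub>1 d then d else V - Y - d)"
      have a': "a' \<in> {a, V - X - a}" and d': "d' \<in> {d, V - Y - d}" by (simp_all add: a'_def d'_def)
      note s = sa[OF a'] sd[OF d']
      have b: "big V E \<tau>\<^sub>1 a'" "\<not> big V E \<tau>\<^sub>2 a'" "big V E \<tau>\<^sub>1 d'" "\<not> big V E \<tau>\<^sub>2 d'"
        using a(2) False big_side_compl[OF tg(1) a(1)] big_side_compl[OF tg(2) a(1)]
          big_side_compl[OF tg(1) d(1)] big_side_compl[OF tg(2) d(1)] by (auto simp: a'_def d'_def)
      have "separates V E \<tau>\<^sub>1 \<tau>\<^sub>2 (corner X Y a' d')"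
        by (rule corner_separates[OF tg(1,2) s]) (use b in simp)
      moreover have "separates V E \<tau>\<^sub>1 \<tau>\<^sub>2 (corner X Y (V - X - a') (V - Y - d'))"
        by (rule corner_separates[OF tg(1,2) side_compl[OF s(1)] side_compl[OF s(2)]])
          (use b big_side_compl[OF tg(1) s(1)] big_side_compl[OF tg(2) s(1)]
            big_side_compl[OF tg(1) s(2)] big_side_compl[OF tg(2) s(2)] in simp)
      ultimately show ?thesis
        using efficient_corners[OF X eff(1) s] eff eq a' d' by blast
    qed
  qed
qed

lemma full_comp_side:
  assumes "C \<in> full_comps V E X" "finite X"
  shows "side V E X C"
  using assms nbhd_sub[of V E C] by (auto simp: side_def full_comps_iff)

lemma uncross_efficient:
  assumes tg: "aleph0_tangle V E \<tau>\<^sub>1" "aleph0_tangle V E \<tau>\<^sub>2" "aleph0_tangle V E \<sigma>\<^sub>1" "aleph0_tangle V E \<sigma>\<^sub>2"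
    and ineq: "\<not> equivalent_tangles V E \<tau>\<^sub>1 \<tau>\<^sub>2" "\<not> equivalent_tangles V E \<sigma>\<^sub>1 \<sigma>\<^sub>2"
    and X: "efficient V E \<tau>\<^sub>1 \<tau>\<^sub>2 X" and Y: "efficient V E \<sigma>\<^sub>1 \<sigma>\<^sub>2 Y" and card: "card Y \<le> card X"
    and cross: "\<not> nest V E X Y"
  shows "\<exists>c c'. (\<forall>W. tight V E W \<longrightarrow> nest V E W X \<and> nest V E W Y \<longrightarrow> nest V E W c \<and> nest V E W c') \<and>
    (\<forall>W. tight V E W \<longrightarrow> nest V E W X \<or> nest V E W Y \<longrightarrow> nest V E W c \<or> nest V E W c') \<and>
    nest V E X c \<and> nest V E X c' \<and> nest V E Y c \<and> nest V E Y c' \<and>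
    (efficient V E \<tau>\<^sub>1 \<tau>\<^sub>2 c \<and> efficient V E \<sigma>\<^sub>1 \<sigma>\<^sub>2 c' \<or>
     card X = card Y \<and> efficient V E \<tau>\<^sub>1 \<tau>\<^sub>2 c \<and> efficient V E \<tau>\<^sub>1 \<tau>\<^sub>2 c' \<and>
       efficient V E \<tau>\<^sub>1 \<tau>\<^sub>2 Y \<and> efficient V E \<sigma>\<^sub>1 \<sigma>\<^sub>2 X)"
proof -
  have tight: "tight V E X" "tight V E Y"
    using efficient_tight[OF tg(1,2) X] efficient_tight[OF tg(3,4) Y] .
  obtain C where C: "C \<in> full_comps V E X" "big V E \<tau>\<^sub>1 C \<noteq> big V E \<tau>\<^sub>2 C"
    using efficient_comp[OF tg(1,2) X] ineq(1) unfolding equivalent_tangles_iff[OF tg(1,2)] by blast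
  obtain D where D: "D \<in> full_comps V E Y" "big V E \<sigma>\<^sub>1 D \<noteq> big V E \<sigma>\<^sub>2 D"
    using efficient_comp[OF tg(3,4) Y] ineq(2) unfolding equivalent_tangles_iff[OF tg(3,4)] by blast
  have sides: "side V E X C" "side V E Y D"
    using full_comp_side C(1) D(1) tight by (auto simp: tight_def)
  obtain a d c c' where a: "a \<in> {C, V - X - C}" and d: "d \<in> {D, V - Y - D}"
    and c: "c = corner X Y a d" and c': "c' = corner X Y (V - X - a) (V - Y - d)"
    and eff: "efficient V E \<tau>\<^sub>1 \<tau>\<^sub>2 c \<and> efficient V E \<sigma>\<^sub>1 \<sigma>\<^sub>2 c' \<or>
      card X = card Y \<and> efficient V E \<tau>\<^sub>1 \<tau>\<^sub>2 c \<and> efficient V E \<tau>\<^sub>1 \<tau>\<^sub>2 c' \<and>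
        efficient V E \<tau>\<^sub>1 \<tau>\<^sub>2 Y \<and> efficient V E \<sigma>\<^sub>1 \<sigma>\<^sub>2 X"
    using uncross_opposite_corners[OF tg X Y card sides(1) C(2) sides(2) D(2)] by blast
  have tc: "tight V E c" "tight V E c'"
    using eff efficient_tight[OF tg(1,2)] efficient_tight[OF tg(3,4)] by blast+
  have "a = C \<or> a = V - X - C" "d = D \<or> d = V - Y - D" using a d by auto
  note cc = crossing_corners[OF tight cross C(1) this(1) D(1) this(2) c tc(1) c' tc(2)]
  show ?thesis
    by (rule exI[of _ c], rule exI[of _ c']) (use cc eff in blast)
qed

section \<open>The tree set\<close>

lemma tangle_mem_separates:
  assumes tg: "aleph0_tangle V E \<tau>\<^sub>1" "aleph0_tangle V E \<tau>\<^sub>2" and "(A, B) \<in> \<tau>\<^sub>1" "(A, B) \<notin> \<tau>\<^sub>2"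
  shows "separates V E \<tau>\<^sub>1 \<tau>\<^sub>2 (A \<inter> B)"
proof -
  have fin: "fin_osep V E A B" using tangle_fin_osep[OF tg(1) assms(3)] .
  then have "big V E \<tau>\<^sub>1 (B - A)" "\<not> big V E \<tau>\<^sub>2 (B - A)"
    using tangle_iff_big[OF tg(1) fin] tangle_iff_big[OF tg(2) fin] assms(3,4) by blast+
  moreover have "B - A \<subseteq> V - A \<inter> B" "finite (A \<inter> B)" "A \<inter> B \<subseteq> V"
    using fin by (auto simp: fin_osep_def)
  ultimately show ?thesis
    using fin_osep_nbhd_Diff[OF fin] unfolding separates_def by blast
qed

lemma distinguishes_separates:
  assumes tg: "aleph0_tangle V E \<tau>\<^sub>1" "aleph0_tangle V E \<tau>\<^sub>2" and "distinguishes s \<tau>\<^sub>1 \<tau>\<^sub>2"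
  shows "separates V E \<tau>\<^sub>1 \<tau>\<^sub>2 (\<Inter>s)"
proof -
  obtain A B where s: "s = {A, B}" and AB: "(A, B) \<in> \<tau>\<^sub>1" "(B, A) \<in> \<tau>\<^sub>2"
    using assms(3) unfolding distinguishes_def by (metis insert_commute)
  have "(A, B) \<notin> \<tau>\<^sub>2" using tangle_antisym[OF tg(2)] AB(2) by blast
  from tangle_mem_separates[OF tg AB(1) this] show ?thesis by (simp add: s)
qed

text \<open>Distinctness is a separate assumption, since a tangle without a core is not equivalent
  even to itself.\<close>

lemma efficient_exists:
  assumes tg: "aleph0_tangle V E \<tau>\<^sub>1" "aleph0_tangle V E \<tau>\<^sub>2" and "\<tau>\<^sub>1 \<noteq> \<tau>\<^sub>2"
  shows "\<exists>X. efficient V E \<tau>\<^sub>1 \<tau>\<^sub>2 X"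
proof -
  have "\<exists>X. separates V E \<tau>\<^sub>1 \<tau>\<^sub>2 X"
  proof -
    obtain A B where "(A, B) \<in> \<tau>\<^sub>1 \<and> (A, B) \<notin> \<tau>\<^sub>2 \<or> (A, B) \<in> \<tau>\<^sub>2 \<and> (A, B) \<notin> \<tau>\<^sub>1"
      using assms(3) by auto
    then show ?thesis
      using tangle_mem_separates[OF tg] tangle_mem_separates[OF tg(2,1)]
        separates_commute[OF tg(2,1)] by blast
  qed
  then obtain X0 where "separates V E \<tau>\<^sub>1 \<tau>\<^sub>2 X0" ..
  from ex_has_least_nat[of "separates V E \<tau>\<^sub>1 \<tau>\<^sub>2", OF this, of card]
  show ?thesis unfolding efficient_def by blast
qed

lemma tight_sub: "tight V E X \<Longrightarrow> finite X \<and> X \<subseteq> V"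
  by (auto simp: tight_def full_comps_iff nbhd_def)

lemma arms_nonempty:
  assumes "tight V E X" "\<C> \<in> arms V E \<rho> X"
  shows "\<Union>\<C> \<noteq> {}"
proof -
  have "\<C> \<noteq> {}" using assms(2) tight_other[OF assms(1), of "\<rho> X"] by (auto simp: arms_def)
  then obtain C where "C \<in> \<C>" by blast
  moreover from this have "C \<noteq> {}" using arms_sub[OF assms(2)] by (auto simp: full_comps_iff dest: subsetD)
  ultimately show ?thesis by blast
qed

text \<open>Both sides are proper subsets of \<open>V\<close>: tightness makes the arm nonempty, and
  the root stays outside it. Degenerate and trivial orientations are excluded by this alone.\<close>

lemma arms_sep:
  assumes \<rho>: "root_choice V E \<rho>" and X: "tight V E X" and C: "\<C> \<in> arms V E \<rho> X"
  shows "fin_osep V E (V - \<Union>\<C>) (X \<union> \<Union>\<C>)" "V - \<Union>\<C> \<noteq> V" "X \<union> \<Union>\<C> \<noteq> V"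
    "X \<inter> \<Union>\<C> = {}" "\<Union>\<C> \<subseteq> V" "X \<subseteq> V"
proof -
  have sub: "\<C> \<subseteq> full_comps V E X" using arms_sub[OF C] by blast
  note U = full_comp_nbhd_Union[OF sub]
  have Xf: "finite X" "X \<subseteq> V" using tight_sub[OF X] by auto
  show *: "X \<inter> \<Union>\<C> = {}" "\<Union>\<C> \<subseteq> V" "X \<subseteq> V" using U(2) Xf by blast+
  from fin_osep_nbhd[OF *(2) Xf(2) U(1) Xf(1)]
  show "fin_osep V E (V - \<Union>\<C>) (X \<union> \<Union>\<C>)" by (simp add: Un_commute)
  show "V - \<Union>\<C> \<noteq> V" using arms_nonempty[OF X C] *(2) by blast
  have R: "\<rho> X \<in> full_comps V E X"
    using \<rho> tight_full_comps[OF X] by (simp add: root_choice_def)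
  have "\<rho> X \<inter> C = {}" if "C \<in> \<C>" for C
    by (rule full_comp_disjoint[OF R]) (use that arms_sub[OF C] in \<open>auto dest: full_comps_comps\<close>)
  moreover have "\<rho> X \<noteq> {}" "\<rho> X \<subseteq> V - X" using R by (auto simp: full_comps_iff)
  ultimately show "X \<union> \<Union>\<C> \<noteq> V" by blast
qed

lemma arms_tame:
  assumes \<rho>: "root_choice V E \<rho>" and X: "tight V E X" and C: "\<C> \<in> arms V E \<rho> X"
  shows "tame V E (underlying (comp_sep V X \<C>))"
  unfolding tame_def
proof (intro conjI exI)
  have sub: "\<C> \<subseteq> full_comps V E X" using arms_sub[OF C] by blast
  show "underlying (comp_sep V X \<C>) \<in> fin_separations V E"
    using arms_sep(1)[OF assms] by (simp add: comp_sep_def fin_separations_iff)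
  show "X \<subseteq> V" using tight_sub[OF X] by blast
  show "\<C> \<subseteq> comps V E X" using sub full_comps_comps by fast
  show "\<not> (\<exists>Y\<subseteq>X. infinite (comps_nbhd V E X Y \<inter> \<C>) \<and> infinite (comps_nbhd V E X Y - \<C>))"
  proof safe
    fix Y assume Y: "infinite (comps_nbhd V E X Y \<inter> \<C>)" "infinite (comps_nbhd V E X Y - \<C>)"
    have "Y = X"
    proof (rule ccontr)
      assume "Y \<noteq> X"
      then have "comps_nbhd V E X Y \<inter> \<C> = {}" using sub by (auto simp: comps_nbhd_def)
      with Y(1) show False by simp
    qed
    \<comment> \<open>Only \<open>Y = X\<close> remains, and there an arm is either a singleton or
      misses nothing but the root.\<close>
    from C show False unfolding arms_def
    proof (elim insertE imageE)
      assume "\<C> = full_comps V E X - {\<rho> X}"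
      then have "comps_nbhd V E X Y - \<C> \<subseteq> {\<rho> X}" using \<open>Y = X\<close> by blast
      then show False using Y(2) finite_subset by blast
    next
      fix D assume "\<C> = {D}"
      then show False using Y(1) by simp
    qed
  qed
qed simp

lemma nested_sides_nested:
  assumes "nested_sides X S Y S'" "X \<subseteq> V" "Y \<subseteq> V" "S \<subseteq> V" "S' \<subseteq> V" "X \<inter> S = {}" "Y \<inter> S' = {}"
  shows "\<exists>p q. underlying p = {V - S, X \<union> S} \<and> underlying q = {V - S', Y \<union> S'} \<and>
    (osep_le p q \<or> osep_le q p)"
  using assms(1) unfolding nested_sides_def
proof (elim disjE)
  assume "S \<inter> S' = {} \<and> X \<inter> S' = {} \<and> Y \<inter> S = {}"
  then have "osep_le (X \<union> S, V - S) (V - S', Y \<union> S')" using assms by auto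
  moreover have "underlying (X \<union> S, V - S) = {V - S, X \<union> S}"
    "underlying (V - S', Y \<union> S') = {V - S', Y \<union> S'}" by auto
  ultimately show ?thesis by blast
next
  assume "S \<subseteq> S' \<and> X \<subseteq> Y \<union> S'"
  then have "osep_le (X \<union> S, V - S) (Y \<union> S', V - S')" using assms by auto
  moreover have "underlying (X \<union> S, V - S) = {V - S, X \<union> S}"
    "underlying (Y \<union> S', V - S') = {V - S', Y \<union> S'}" by auto
  ultimately show ?thesis by blast
next
  assume "S' \<subseteq> S \<and> Y \<subseteq> X \<union> S"
  then have "osep_le (Y \<union> S', V - S') (X \<union> S, V - S)" using assms by auto
  moreover have "underlying (X \<union> S, V - S) = {V - S, X \<union> S}"
    "underlying (Y \<union> S', V - S') = {V - S', Y \<union> S'}" by auto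
  ultimately show ?thesis by blast
qed

definition arm_seps :: "'a set \<Rightarrow> 'a set set \<Rightarrow> ('a set \<Rightarrow> 'a set) \<Rightarrow> 'a set set \<Rightarrow> 'a sep set" where
  "arm_seps V E \<rho> \<X> = {underlying (comp_sep V X \<C>) | X \<C>. X \<in> \<X> \<and> \<C> \<in> arms V E \<rho> X}"

lemma arm_seps_tree_set:
  assumes \<rho>: "root_choice V E \<rho>" and tight: "\<And>X. X \<in> \<X> \<Longrightarrow> tight V E X"
    and nest: "\<forall>X\<in>\<X>. \<forall>Y\<in>\<X>. nest V E X Y"
  shows "tree_set (arm_seps V E \<rho> \<X>)"
proof -
  let ?T = "arm_seps V E \<rho> \<X>"
  have nested: "nested ?T"
    unfolding nested_def
  proof (intro ballI)
    fix r s assume "r \<in> ?T" "s \<in> ?T"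
    then obtain X \<C> Y \<D> where r: "r = {V - \<Union>\<C>, X \<union> \<Union>\<C>}" "X \<in> \<X>" "\<C> \<in> arms V E \<rho> X"
      and s: "s = {V - \<Union>\<D>, Y \<union> \<Union>\<D>}" "Y \<in> \<X>" "\<D> \<in> arms V E \<rho> Y"
      by (auto simp: arm_seps_def comp_sep_def)
    have "nest V E X Y" using nest r(2) s(2) by blast
    from arms_nested[OF \<rho> tight[OF r(2)] tight[OF s(2)] this r(3) s(3)]
    show "\<exists>p q. underlying p = r \<and> underlying q = s \<and> (osep_le p q \<or> osep_le q p)"
      unfolding r(1) s(1)
      using arms_sep(4-6)[OF \<rho> tight[OF r(2)] r(3)] arms_sep(4-6)[OF \<rho> tight[OF s(2)] s(3)]
      by (intro nested_sides_nested)
  qed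
  have T: "A \<noteq> V \<and> B \<noteq> V \<and> A \<union> B = V" if AB: "underlying (A, B) \<in> ?T" for A B
  proof -
    obtain X \<C> where eq: "{A, B} = {V - \<Union>\<C>, X \<union> \<Union>\<C>}" and X: "X \<in> \<X>" "\<C> \<in> arms V E \<rho> X"
      using AB by (auto simp: arm_seps_def comp_sep_def)
    note sep = arms_sep[OF \<rho> tight[OF X(1)] X(2)]
    have "V - \<Union>\<C> \<union> (X \<union> \<Union>\<C>) = V" using sep(1) by (simp add: fin_osep_def)
    then show ?thesis using eq sep(2,3) by (auto simp: doubleton_eq_iff)
  qed
  have "\<not> degenerate p \<and> \<not> trivial_in ?T p" if "p \<in> orientations ?T" for p
  proof -
    obtain A B where p: "p = (A, B)" by (cases p)
    then have AB: "A \<noteq> V \<and> B \<noteq> V \<and> A \<union> B = V" using that T by (simp add: orientations_def)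
    have "\<not> trivial_in ?T p"
    proof
      assume "trivial_in ?T p"
      then obtain C D where CD: "underlying (C, D) \<in> ?T" "osep_le p (C, D)" "osep_le p (D, C)"
        unfolding trivial_in_def osep_less_def by auto
      have "C \<union> D = V" using T[OF CD(1)] by blast
      \<comment> \<open>An orientation below both \<open>(C, D)\<close> and \<open>(D, C)\<close>
        has a second side containing \<open>C \<union> D\<close>.\<close>
      then have "B = V" using CD(2,3) AB p by auto
      then show False using AB by blast
    qed
    moreover have "\<not> degenerate p" using AB p by (auto simp: degenerate_def)
    ultimately show ?thesis by blast
  qed
  with nested show ?thesis by (simp add: tree_set_def)
qed

lemma arm_seps_efficient:
  assumes \<rho>: "root_choice V E \<rho>" and tg: "aleph0_tangle V E \<tau>\<^sub>1" "aleph0_tangle V E \<tau>\<^sub>2"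
    and ineq: "\<not> equivalent_tangles V E \<tau>\<^sub>1 \<tau>\<^sub>2" and eff: "efficient V E \<tau>\<^sub>1 \<tau>\<^sub>2 X"
  shows "\<exists>\<C>\<in>arms V E \<rho> X. efficiently_distinguishes V E (underlying (comp_sep V X \<C>)) \<tau>\<^sub>1 \<tau>\<^sub>2"
proof -
  have tight: "tight V E X" using efficient_tight[OF tg eff] .
  then have X: "finite X" "X \<subseteq> V" using tight_sub by blast+
  obtain C where C: "C \<in> full_comps V E X" "big V E \<tau>\<^sub>1 C \<noteq> big V E \<tau>\<^sub>2 C"
    using efficient_comp[OF tg eff] ineq unfolding equivalent_tangles_iff[OF tg] by blast
  have "\<exists>\<C>\<in>arms V E \<rho> X. big V E \<tau>\<^sub>1 (\<Union>\<C>) \<noteq> big V E \<tau>\<^sub>2 (\<Union>\<C>)"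
  proof (cases "C = \<rho> X")
    case False
    then have "{C} \<in> arms V E \<rho> X" using C(1) by (simp add: arms_def)
    then show ?thesis using C(2) by (intro bexI[of _ "{C}"]) simp_all
  next
    case True
    \<comment> \<open>The root itself distinguishes the tangles. Both live in the full components of
      \<open>G - X\<close>, so for each of them the large arm is big exactly when the root is
      not.\<close>
    let ?\<C> = "full_comps V E X - {C}"
    have fin: "finite (nbhd V E (\<Union>\<P>))" "\<Union>\<P> \<subseteq> V" if "\<P> \<subseteq> full_comps V E X" for \<P>
      using full_comp_nbhd_Union[OF that] X by (auto intro: finite_subset)
    have Ceq: "C \<union> \<Union>?\<C> = \<Union>(full_comps V E X)" using C(1) by blast
    have "D \<inter> C = {}" if "D \<in> ?\<C>" for D
      by (rule full_comp_disjoint[OF _ full_comps_comps[OF C(1)]]) (use that in auto)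
    then have disj: "C \<inter> \<Union>?\<C> = {}" by blast
    have iff: "big V E \<tau> (\<Union>?\<C>) \<longleftrightarrow> \<not> big V E \<tau> C"
      if tau: "aleph0_tangle V E \<tau>" "big V E \<tau> (\<Union>\<P>)" "\<P> \<subseteq> full_comps V E X" for \<tau> \<P>
    proof -
      have "big V E \<tau> (\<Union>(full_comps V E X))"
        by (rule big_mono[OF tau(1,2) Union_mono[OF tau(3)] fin(2,1)]) simp_all
      then have "big V E \<tau> (C \<union> \<Union>?\<C>)" by (simp only: Ceq)
      moreover have "finite (nbhd V E C)" "finite (nbhd V E (\<Union>?\<C>))"
        using C(1) X(1) fin(1)[of ?\<C>] by (auto simp: full_comps_iff)
      ultimately have "big V E \<tau> C \<or> big V E \<tau> (\<Union>?\<C>)" by (rule big_Un[OF tau(1)])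
      then show ?thesis using big_disjoint[OF tau(1) _ _ disj] by blast
    qed
    have "big V E \<tau>\<^sub>1 (\<Union>?\<C>) \<longleftrightarrow> \<not> big V E \<tau>\<^sub>1 C"
      using efficient_full[OF tg eff] iff[OF tg(1)] by blast
    moreover have "big V E \<tau>\<^sub>2 (\<Union>?\<C>) \<longleftrightarrow> \<not> big V E \<tau>\<^sub>2 C"
      using efficient_full[OF tg(2,1) efficient_commute[OF tg eff]] iff[OF tg(2)] by blast
    moreover have "?\<C> \<in> arms V E \<rho> X" using True by (simp add: arms_def)
    ultimately show ?thesis using C(2) by blast
  qed
  then obtain \<C> where \<C>: "\<C> \<in> arms V E \<rho> X" "big V E \<tau>\<^sub>1 (\<Union>\<C>) \<noteq> big V E \<tau>\<^sub>2 (\<Union>\<C>)" by blast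
  let ?A = "V - \<Union>\<C>" and ?B = "X \<union> \<Union>\<C>"
  have sub: "\<C> \<subseteq> comps V E X" using arms_sub[OF \<C>(1)] full_comps_comps by fast
  note sep = arms_sep[OF \<rho> tight \<C>(1)]
  have "(?A, ?B) \<in> \<tau>\<^sub>1 \<longleftrightarrow> (?A, ?B) \<notin> \<tau>\<^sub>2"
    using comp_sep_iff_big[OF tg(1) sub X] comp_sep_iff_big[OF tg(2) sub X] \<C>(2)
    by (simp add: comp_sep_def)
  then have dist: "distinguishes {?A, ?B} \<tau>\<^sub>1 \<tau>\<^sub>2"
    using tangle_total[OF tg(1) sep(1)] tangle_total[OF tg(2) sep(1)]
    unfolding distinguishes_def by blast
  have "{?A, ?B} \<in> separations V E"
    using sep(1) unfolding fin_separations_iff[symmetric] by (simp add: fin_separations_def)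
  moreover have "\<Inter>{?A, ?B} = X" using sep(4-6) by auto
  ultimately have "efficiently_distinguishes V E {?A, ?B} \<tau>\<^sub>1 \<tau>\<^sub>2"
    using dist eff distinguishes_separates[OF tg]
    unfolding efficiently_distinguishes_def efficient_def by simp
  then show ?thesis using \<C>(1) by (intro bexI[of _ \<C>]) (simp_all add: comp_sep_def)
qed

text \<open>Beyond their common core \<open>Z\<close>, the tangles may differ as ultrafilters on the
  full components of \<open>G - Z\<close>. Arms cannot see this difference, as the position of
  \<open>Z\<close> relative to \<open>X\<close> shows.\<close>

lemma core_big_arms:
  assumes tg: "aleph0_tangle V E \<tau>\<^sub>1" "aleph0_tangle V E \<tau>\<^sub>2"
    and core: "core V E \<tau>\<^sub>1 Z" "core V E \<tau>\<^sub>2 Z" and X: "tight V E X" and C: "\<C> \<in> arms V E \<rho> X"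
    and big: "big V E \<tau>\<^sub>1 (\<Union>\<C>)"
  shows "big V E \<tau>\<^sub>2 (\<Union>\<C>)"
proof -
  have Xf: "finite X" "X \<subseteq> V" using tight_sub[OF X] by auto
  have sub: "\<C> \<subseteq> full_comps V E X" using arms_sub[OF C] by blast
  then have subc: "\<C> \<subseteq> comps V E X" using full_comps_comps by fast
  have fin: "finite (nbhd V E (\<Union>\<P>))" "\<Union>\<P> \<subseteq> V" if "\<P> \<subseteq> comps V E X" for \<P>
    using comps_Union[OF that] Xf by (auto intro: finite_subset)
  let ?F = "{C \<in> full_comps V E Z. C \<inter> X = {}}"
  have bF: "big V E \<tau>\<^sub>1 (\<Union>?F)" "big V E \<tau>\<^sub>2 (\<Union>?F)"
    using core_avoiding[OF tg(1) core(1) Xf(1)] core_avoiding[OF tg(2) core(2) Xf(1)] .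
  consider "Z = X" | "Z \<subset> X" | "Z - X \<noteq> {}" by blast
  then show ?thesis
  proof cases
    case 1
    \<comment> \<open>At the core itself no single component is big, so the arm must be the large
      one, which omits a single component and is big for both tangles.\<close>
    have nb: "\<not> big V E \<tau>\<^sub>1 D \<and> \<not> big V E \<tau>\<^sub>2 D" if "D \<in> full_comps V E X" for D
      using core that 1 by (simp add: core_def)
    from C show ?thesis unfolding arms_def
    proof (elim insertE imageE)
      assume eq: "\<C> = full_comps V E X - {\<rho> X}"
      show ?thesis
      proof (cases "\<rho> X \<in> full_comps V E X")
        case False
        then show ?thesis using core(2) eq 1 by (simp add: core_def)
      next
        case True
        then have "\<rho> X \<union> \<Union>\<C> = \<Union>(full_comps V E X)" using eq by blast
        then have b: "big V E \<tau>\<^sub>2 (\<rho> X \<union> \<Union>\<C>)" using core(2) 1 by (simp add: core_def)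
        have "finite (nbhd V E (\<rho> X))" using True Xf by (simp add: full_comps_iff)
        from big_Un[OF tg(2) b this fin(1)[OF subc]] nb[OF True] show ?thesis by blast
      qed
    next
      fix D assume "\<C> = {D}" "D \<in> full_comps V E X - {\<rho> X}"
      then show ?thesis using big nb[of D] by simp
    qed
  next
    case 2
    \<comment> \<open>The components carrying the tangle are also components of
      \<open>G - X\<close>, but with neighbourhood \<open>Z \<noteq> X\<close>; arms contain only
      full ones and cannot be big.\<close>
    have "D \<inter> C = {}" if D: "D \<in> ?F" and C: "C \<in> \<C>" for C D
    proof (rule ccontr)
      assume meet: "D \<inter> C \<noteq> {}"
      have D': "D \<noteq> {}" "D \<subseteq> V" "D \<inter> X = {}" "connected_graph D E" "nbhd V E D = Z"
        using D by (auto simp: full_comps_iff)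
      then have "D \<in> comps V E X" using 2 by (auto simp: comps_iff)
      from comps_eqI[OF this subsetD[OF subc C] meet] have "D = C" .
      moreover have "nbhd V E C = X" using subsetD[OF sub C] by (simp add: full_comps_iff)
      ultimately show False using D'(5) 2 by blast
    qed
    then have "\<Union>?F \<inter> \<Union>\<C> = {}" by blast
    from big_disjoint[OF tg(1) bF(1) big this] show ?thesis ..
  next
    case 3
    \<comment> \<open>A vertex of \<open>Z\<close> outside \<open>X\<close> ties all full components
      of \<open>G - Z\<close> that avoid \<open>X\<close> into one component \<open>K\<close> of
      \<open>G - X\<close>, in which both tangles live.\<close>
    then obtain z where z: "z \<in> Z" "z \<notin> X" by blast
    have "z \<in> V" using z(1) core(1) by (auto simp: core_def)
    then obtain K where K: "K \<in> comps V E X" "z \<in> K" using comps_cover[of z V X E] z(2) by blast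
    have "D \<subseteq> K" if D: "D \<in> ?F" for D
    proof -
      have Df: "D \<in> full_comps V E Z" "D \<inter> X = {}" using D by auto
      from full_comp_avoiding[OF this] obtain L where L: "L \<in> comps V E X" "D \<union> (Z - X) \<subseteq> L" ..
      have "L = K" by (rule comps_eqI[OF L(1) K(1)]) (use L(2) K(2) z in blast)
      then show ?thesis using L(2) by blast
    qed
    then have FK: "\<Union>?F \<subseteq> K" by blast
    have finK: "finite (nbhd V E K)" "K \<subseteq> V" using fin[of "{K}"] K(1) by auto
    have bK: "big V E \<tau>\<^sub>1 K" "big V E \<tau>\<^sub>2 K"
      using big_mono[OF tg(1) bF(1) FK finK(2,1)] big_mono[OF tg(2) bF(2) FK finK(2,1)] .
    have "K \<in> \<C>" by (rule big_full_comp_mem[OF tg(1) bK(1) K(1) big subc])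
    then have "K \<subseteq> \<Union>\<C>" by blast
    from big_mono[OF tg(2) bK(2) this fin(2,1)[OF subc]] show ?thesis .
  qed
qed

lemma equivalent_orient_arm_seps:
  assumes \<rho>: "root_choice V E \<rho>" and tight: "\<And>X. X \<in> \<X> \<Longrightarrow> tight V E X"
    and tg: "aleph0_tangle V E \<tau>\<^sub>1" "aleph0_tangle V E \<tau>\<^sub>2" and eq: "equivalent_tangles V E \<tau>\<^sub>1 \<tau>\<^sub>2"
  shows "\<tau>\<^sub>1 \<inter> orientations (arm_seps V E \<rho> \<X>) \<subseteq> \<tau>\<^sub>2"
proof
  fix p assume p: "p \<in> \<tau>\<^sub>1 \<inter> orientations (arm_seps V E \<rho> \<X>)"
  obtain A B where AB: "p = (A, B)" by (cases p)
  obtain Z where Z: "core V E \<tau>\<^sub>1 Z" "core V E \<tau>\<^sub>2 Z"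
    using eq unfolding equivalent_tangles_iff[OF tg] by blast
  have "underlying (A, B) \<in> arm_seps V E \<rho> \<X>" using p AB by (simp add: orientations_def)
  then obtain X \<C> where s: "{A, B} = {V - \<Union>\<C>, X \<union> \<Union>\<C>}" and X: "X \<in> \<X>" "\<C> \<in> arms V E \<rho> X"
    by (auto simp: arm_seps_def comp_sep_def)
  have Xf: "finite X" "X \<subseteq> V" using tight_sub[OF tight[OF X(1)]] by auto
  have sub: "\<C> \<subseteq> comps V E X" using arms_sub[OF X(2)] full_comps_comps by fast
  have iff: "(V - \<Union>\<C>, X \<union> \<Union>\<C>) \<in> \<tau>\<^sub>1 \<longleftrightarrow> (V - \<Union>\<C>, X \<union> \<Union>\<C>) \<in> \<tau>\<^sub>2"
    using comp_sep_iff_big[OF tg(1) sub Xf] comp_sep_iff_big[OF tg(2) sub Xf]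
      core_big_arms[OF tg Z tight[OF X(1)] X(2)]
      core_big_arms[OF tg(2,1) Z(2,1) tight[OF X(1)] X(2)]
    unfolding comp_sep_def by blast
  from s consider "A = V - \<Union>\<C>" "B = X \<union> \<Union>\<C>" | "B = V - \<Union>\<C>" "A = X \<union> \<Union>\<C>"
    by (auto simp: doubleton_eq_iff)
  then have "(A, B) \<in> \<tau>\<^sub>2"
  proof cases
    case 1
    then show ?thesis using p AB iff by simp
  next
    case 2
    have "(B, A) \<notin> \<tau>\<^sub>1" using tangle_antisym[OF tg(1)] p AB by blast
    then have "(B, A) \<notin> \<tau>\<^sub>2" using iff 2 by simp
    then show ?thesis
      using tangle_total[OF tg(2) arms_sep(1)[OF \<rho> tight[OF X(1)] X(2)]] 2 by simp
  qed
  then show "p \<in> \<tau>\<^sub>2" using AB by simp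
qed

lemma nested_efficient_separators:
  fixes V :: "'a set" and E :: "'a set set"
  shows "\<exists>\<X>. (\<forall>X\<in>\<X>. tight V E X) \<and> (\<forall>X\<in>\<X>. \<forall>Y\<in>\<X>. nest V E X Y) \<and>
    (\<forall>\<tau>\<^sub>1 \<tau>\<^sub>2. aleph0_tangle V E \<tau>\<^sub>1 \<longrightarrow> aleph0_tangle V E \<tau>\<^sub>2 \<longrightarrow> \<tau>\<^sub>1 \<noteq> \<tau>\<^sub>2 \<longrightarrow>
       \<not> equivalent_tangles V E \<tau>\<^sub>1 \<tau>\<^sub>2 \<longrightarrow> (\<exists>X\<in>\<X>. efficient V E \<tau>\<^sub>1 \<tau>\<^sub>2 X))"
proof -
  \<comment> \<open>All pairs serve as indices; a pair that does not consist of inequivalent tangles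
    gets an empty set of candidates.\<close>
  define A where "A = (\<lambda>(\<tau>\<^sub>1, \<tau>\<^sub>2). {X. aleph0_tangle V E \<tau>\<^sub>1 \<and> aleph0_tangle V E \<tau>\<^sub>2 \<and>
    \<not> equivalent_tangles V E \<tau>\<^sub>1 \<tau>\<^sub>2 \<and> efficient V E \<tau>\<^sub>1 \<tau>\<^sub>2 X})"
  have A_iff: "X \<in> A (\<tau>\<^sub>1, \<tau>\<^sub>2) \<longleftrightarrow> aleph0_tangle V E \<tau>\<^sub>1 \<and> aleph0_tangle V E \<tau>\<^sub>2 \<and>
    \<not> equivalent_tangles V E \<tau>\<^sub>1 \<tau>\<^sub>2 \<and> efficient V E \<tau>\<^sub>1 \<tau>\<^sub>2 X" for X \<tau>\<^sub>1 \<tau>\<^sub>2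
    by (simp add: A_def)
  have tight: "tight V E X" if "X \<in> A i" for X i
    using that efficient_tight by (cases i) (auto simp: A_iff)
  have "\<exists>N\<subseteq>\<Union>(range A). (\<forall>X\<in>N. \<forall>Y\<in>N. nest V E X Y) \<and> (\<forall>i. A i \<noteq> {} \<longrightarrow> N \<inter> A i \<noteq> {})"
  proof (rule splinter[where ord = card])
    fix i X Y assume "X \<in> A i" "Y \<in> A i"
    then show "card X = card Y"
      by (cases i) (auto simp: A_iff efficient_def intro: antisym)
  next
    fix i X assume "X \<in> A i"
    then show "nest V E X X" using nest_refl tight by blast
  next
    fix i j X Y assume "X \<in> A i" "Y \<in> A j" "nest V E X Y"
    then show "nest V E Y X" using nest_sym tight by blast
  next
    fix i X k assume "X \<in> A i"
    then have "finite {W. tight V E W \<and> card W = k \<and> \<not> nest V E W X}"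
      by (intro finite_crossing tight)
    then show "finite {W \<in> \<Union>(range A). card W = k \<and> \<not> nest V E W X}"
      by (rule finite_subset[rotated]) (use tight in blast)
  next
    fix i j X Y assume X: "X \<in> A i" and Y: "Y \<in> A j" and le: "card Y \<le> card X" and cross: "\<not> nest V E X Y"
    obtain \<tau>\<^sub>1 \<tau>\<^sub>2 where i: "i = (\<tau>\<^sub>1, \<tau>\<^sub>2)" by (cases i)
    obtain \<sigma>\<^sub>1 \<sigma>\<^sub>2 where j: "j = (\<sigma>\<^sub>1, \<sigma>\<^sub>2)" by (cases j)
    have \<tau>: "aleph0_tangle V E \<tau>\<^sub>1" "aleph0_tangle V E \<tau>\<^sub>2" "\<not> equivalent_tangles V E \<tau>\<^sub>1 \<tau>\<^sub>2" "efficient V E \<tau>\<^sub>1 \<tau>\<^sub>2 X"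
      using X by (simp_all add: i A_iff)
    have \<sigma>: "aleph0_tangle V E \<sigma>\<^sub>1" "aleph0_tangle V E \<sigma>\<^sub>2" "\<not> equivalent_tangles V E \<sigma>\<^sub>1 \<sigma>\<^sub>2" "efficient V E \<sigma>\<^sub>1 \<sigma>\<^sub>2 Y"
      using Y by (simp_all add: j A_iff)
    have Ai: "W \<in> A i \<longleftrightarrow> efficient V E \<tau>\<^sub>1 \<tau>\<^sub>2 W" and Aj: "W \<in> A j \<longleftrightarrow> efficient V E \<sigma>\<^sub>1 \<sigma>\<^sub>2 W" for W
      using \<tau> \<sigma> by (simp_all add: i j A_iff)
    have tightA: "tight V E W" if "W \<in> \<Union>(range A)" for W
      using that tight by blast
    obtain c d where cd: "\<And>W. tight V E W \<Longrightarrow> nest V E W X \<and> nest V E W Y \<longrightarrow> nest V E W c \<and> nest V E W d"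
        "\<And>W. tight V E W \<Longrightarrow> nest V E W X \<or> nest V E W Y \<longrightarrow> nest V E W c \<or> nest V E W d"
        "nest V E X c" "nest V E X d" "nest V E Y c" "nest V E Y d"
        "c \<in> A i \<and> d \<in> A j \<or> card X = card Y \<and> c \<in> A i \<and> d \<in> A i \<and> Y \<in> A i \<and> X \<in> A j"
      using uncross_efficient[OF \<tau>(1,2) \<sigma>(1,2) \<tau>(3) \<sigma>(3) \<tau>(4) \<sigma>(4) le cross] unfolding Ai Aj by blast
    show "\<exists>c d. (\<forall>w\<in>\<Union>(range A). nest V E w X \<and> nest V E w Y \<longrightarrow> nest V E w c \<and> nest V E w d) \<and>
        (\<forall>w\<in>\<Union>(range A). nest V E w X \<or> nest V E w Y \<longrightarrow> nest V E w c \<or> nest V E w d) \<and>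
        nest V E X c \<and> nest V E X d \<and> nest V E Y c \<and> nest V E Y d \<and>
        (c \<in> A i \<and> d \<in> A j \<or> card X = card Y \<and> c \<in> A i \<and> d \<in> A i \<and> Y \<in> A i \<and> X \<in> A j)"
      by (rule exI[of _ c], rule exI[of _ d], intro conjI ballI cd(3-7))
        (erule cd(1)[OF tightA] cd(2)[OF tightA])+
  qed
  then obtain N where N: "N \<subseteq> \<Union>(range A)" "\<forall>X\<in>N. \<forall>Y\<in>N. nest V E X Y"
    "\<And>i. A i \<noteq> {} \<Longrightarrow> N \<inter> A i \<noteq> {}" by blast
  show ?thesis
  proof (intro exI[of _ N] conjI allI impI)
    show "\<forall>X\<in>N. tight V E X" using N(1) tight by blast
    show "\<forall>X\<in>N. \<forall>Y\<in>N. nest V E X Y" by (fact N(2))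
    fix \<tau>\<^sub>1 \<tau>\<^sub>2 assume tau: "aleph0_tangle V E \<tau>\<^sub>1" "aleph0_tangle V E \<tau>\<^sub>2" "\<tau>\<^sub>1 \<noteq> \<tau>\<^sub>2"
      "\<not> equivalent_tangles V E \<tau>\<^sub>1 \<tau>\<^sub>2"
    then have "A (\<tau>\<^sub>1, \<tau>\<^sub>2) \<noteq> {}" using efficient_exists[OF tau(1-3)] by (auto simp: A_def)
    from N(3)[OF this] show "\<exists>X\<in>N. efficient V E \<tau>\<^sub>1 \<tau>\<^sub>2 X" by (auto simp: A_def)
  qed
qed

theorem theorem1:
  fixes V :: "'a set" and E :: "'a set set"
  assumes "simple_graph V E"
    and "connected_graph V E"
  shows "\<exists>T. T \<subseteq> fin_separations V E \<and> (\<forall>s\<in>T. tame V E s) \<and> tree_set T \<and>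
    (\<forall>\<tau>\<^sub>1 \<tau>\<^sub>2. aleph0_tangle V E \<tau>\<^sub>1 \<longrightarrow> aleph0_tangle V E \<tau>\<^sub>2 \<longrightarrow> \<tau>\<^sub>1 \<noteq> \<tau>\<^sub>2 \<longrightarrow>
       \<not> equivalent_tangles V E \<tau>\<^sub>1 \<tau>\<^sub>2 \<longrightarrow>
       (\<exists>s\<in>T. efficiently_distinguishes V E s \<tau>\<^sub>1 \<tau>\<^sub>2)) \<and>
    (\<forall>\<tau>\<^sub>1 \<tau>\<^sub>2. aleph0_tangle V E \<tau>\<^sub>1 \<longrightarrow> aleph0_tangle V E \<tau>\<^sub>2 \<longrightarrow>
       equivalent_tangles V E \<tau>\<^sub>1 \<tau>\<^sub>2 \<longrightarrow>
       \<tau>\<^sub>1 \<inter> orientations T = \<tau>\<^sub>2 \<inter> orientations T)"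
proof -
  obtain \<rho> :: "'a set \<Rightarrow> 'a set" where \<rho>: "root_choice V E \<rho>"
    using root_choice_exists by blast
  obtain \<X> where tight': "\<forall>X\<in>\<X>. tight V E X"
    and nest: "\<forall>X\<in>\<X>. \<forall>Y\<in>\<X>. nest V E X Y"
    and dist: "\<forall>\<tau>\<^sub>1 \<tau>\<^sub>2. aleph0_tangle V E \<tau>\<^sub>1 \<longrightarrow> aleph0_tangle V E \<tau>\<^sub>2 \<longrightarrow> \<tau>\<^sub>1 \<noteq> \<tau>\<^sub>2 \<longrightarrow>
      \<not> equivalent_tangles V E \<tau>\<^sub>1 \<tau>\<^sub>2 \<longrightarrow> (\<exists>X\<in>\<X>. efficient V E \<tau>\<^sub>1 \<tau>\<^sub>2 X)"
    using nested_efficient_separators[of V E] by (elim exE conjE) (rule that)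
  have tight: "tight V E X" if "X \<in> \<X>" for X
    using tight' that by blast
  let ?T = "arm_seps V E \<rho> \<X>"
  have tame: "tame V E s" if "s \<in> ?T" for s
    using that arms_tame[OF \<rho> tight] by (auto simp: arm_seps_def)
  show ?thesis
  proof (intro exI[of _ ?T] conjI allI impI)
    show "?T \<subseteq> fin_separations V E" using tame by (auto simp: tame_def)
    show "\<forall>s\<in>?T. tame V E s" using tame by blast
    show "tree_set ?T" by (rule arm_seps_tree_set[OF \<rho> tight nest])
    fix \<tau>\<^sub>1 \<tau>\<^sub>2 assume tg: "aleph0_tangle V E \<tau>\<^sub>1" "aleph0_tangle V E \<tau>\<^sub>2"
    show "\<exists>s\<in>?T. efficiently_distinguishes V E s \<tau>\<^sub>1 \<tau>\<^sub>2"
      if neq: "\<tau>\<^sub>1 \<noteq> \<tau>\<^sub>2" and ineq: "\<not> equivalent_tangles V E \<tau>\<^sub>1 \<tau>\<^sub>2"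
    proof -
      obtain X where X: "X \<in> \<X>" "efficient V E \<tau>\<^sub>1 \<tau>\<^sub>2 X" using dist tg neq ineq by blast
      from arm_seps_efficient[OF \<rho> tg ineq X(2)] obtain \<C> where "\<C> \<in> arms V E \<rho> X"
        "efficiently_distinguishes V E (underlying (comp_sep V X \<C>)) \<tau>\<^sub>1 \<tau>\<^sub>2" ..
      with X(1) show ?thesis unfolding arm_seps_def by blast
    qed
    show "\<tau>\<^sub>1 \<inter> orientations ?T = \<tau>\<^sub>2 \<inter> orientations ?T" if eq: "equivalent_tangles V E \<tau>\<^sub>1 \<tau>\<^sub>2"
    proof -
      have eq': "equivalent_tangles V E \<tau>\<^sub>2 \<tau>\<^sub>1" using eq by (simp add: equivalent_tangles_def)
      have "\<tau>\<^sub>1 \<inter> orientations ?T \<subseteq> \<tau>\<^sub>2" "\<tau>\<^sub>2 \<inter> orientations ?T \<subseteq> \<tau>\<^sub>1"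
        by (rule equivalent_orient_arm_seps[OF \<rho> tight tg eq], assumption)
          (rule equivalent_orient_arm_seps[OF \<rho> tight tg(2,1) eq'], assumption)
      then show ?thesis by blast
    qed
  qed
qed

end
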